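(* Let $V$ be a vector space with dimension $2n$ over a field $\mathbb{F}$, with $n\geq 2$. Let $\mathbb{L}=\mathbb{F}[a]\subset\mathrm{End}(V)$ be a quadratic extension of $\mathbb{F}$ and $s_0\in\mathcal{A}^2(V)$ be such that the bilinear form $(x,y)\mapsto s_0(x,a(y))$ is nonisotropic. Then $s_0+W_{\mathbb{L}}$ is an irreducible optimal symplectic affine subspace of $\mathcal{A}^2(V)$ with dimension $n(n-1)$.
   Context: $\mathcal{A}^2(V)$ is the space of alternating bilinear forms on $V$. The characteristic of $\mathbb{F}$ is arbitrary. A bilinear form $b$ on $V$ is nonisotropic when $b(x,x)\neq 0$ for all $x\in V\setminus\{0\}$. A quadratic extension $\mathbb{L}\subset\mathrm{End}(V)$ of $\mathbb{F}$ is a subalgebra of $\mathrm{End}(V)$ containing $\mathbb{F}\,\mathrm{id}_V$ (identified with $\mathbb{F}$) that is a field of degree $2$ over $\mathbb{F}$; so $\mathbb{L}=\mathbb{F}[a]$ where $a\in\mathrm{End}(V)$ has an irreducible minimal polynomial of degree $2$. $W_{\mathbb{L}}$ is the set of all bilinear forms $s:V^2\to\mathbb{F}$ such that $s(x,\lambda(x))=0$ for all $x\in V$ and $\lambda\in\mathbb{L}$ (in particular $W_{\mathbb{L}}\subseteq\mathcal{A}^2(V)$). An affine subspace of $\mathcal{A}^2(V)$ is symplectic when all its elements are non-degenerate; it is optimal when it has the greatest possible dimension among symplectic affine subspaces of $\mathcal{A}^2(V)$. A nonempty set $\mathcal{X}$ of symplectic forms on $V$ is irreducible when there is no nonzero linear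 subspace $W$ of $V$ such that the orthogonal $W^{\bot_s}=\{y\in V: s(x,y)=0\ \forall x\in W\}$ includes $W$ for every $s\in\mathcal{X}$ and does not depend on the choice of $s\in\mathcal{X}$. *)

theory Defs
  imports Complex_Main "HOL-Library.Function_Algebras" "HOL-Algebra.Ring"
begin

text \<open>
  The space \<open>V\<close> is the whole type \<open>'v\<close>, with scalar multiplication \<open>sc\<close>. Maps and forms are plain
  functions; their additive structure is the pointwise one of the library theory on function algebras, and their scalar
  multiplication is the following, used once for endomorphisms and twice for forms.
\<close>

definition fun_scale :: "('f \<Rightarrow> 'b \<Rightarrow> 'b) \<Rightarrow> 'f \<Rightarrow> ('a \<Rightarrow> 'b) \<Rightarrow> 'a \<Rightarrow> 'b" where
  "fun_scale sc c f = (\<lambda>x. sc c (f x))"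

lemma vector_space_fun_scale:
  fixes sc :: "'f::field \<Rightarrow> 'b::ab_group_add \<Rightarrow> 'b"
  assumes "vector_space sc"
  shows "vector_space (fun_scale sc :: 'f \<Rightarrow> ('a \<Rightarrow> 'b) \<Rightarrow> 'a \<Rightarrow> 'b)"
proof -
  interpret vector_space sc by fact
  show ?thesis
    by unfold_locales (auto simp: fun_scale_def fun_eq_iff scale_right_distrib scale_left_distrib)
qed

abbreviation form_scale :: "'f::field \<Rightarrow> ('v \<Rightarrow> 'v \<Rightarrow> 'f) \<Rightarrow> 'v \<Rightarrow> 'v \<Rightarrow> 'f" where
  "form_scale \<equiv> fun_scale (fun_scale (*))"

lemma vector_space_form_scale:
  "vector_space (form_scale :: 'f::field \<Rightarrow> ('v \<Rightarrow> 'v \<Rightarrow> 'f) \<Rightarrow> 'v \<Rightarrow> 'v \<Rightarrow> 'f)"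
proof -
  have "vector_space ((*) :: 'f \<Rightarrow> 'f \<Rightarrow> 'f)"
    by unfold_locales (auto simp: algebra_simps)
  then show ?thesis
    by (intro vector_space_fun_scale)
qed


section \<open>Bilinear forms\<close>

definition bilinear_form ::
    "('f::field \<Rightarrow> 'v::ab_group_add \<Rightarrow> 'v) \<Rightarrow> ('v \<Rightarrow> 'v \<Rightarrow> 'f) \<Rightarrow> bool" where
  "bilinear_form sc b \<longleftrightarrow>
     (\<forall>x. Vector_Spaces.linear sc (*) (\<lambda>y. b x y)) \<and>
     (\<forall>y. Vector_Spaces.linear sc (*) (\<lambda>x. b x y))"

definition alternating_forms ::
    "('f::field \<Rightarrow> 'v::ab_group_add \<Rightarrow> 'v) \<Rightarrow> ('v \<Rightarrow> 'v \<Rightarrow> 'f) set" where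
  "alternating_forms sc = {s. bilinear_form sc s \<and> (\<forall>x. s x x = 0)}"

definition nonisotropic :: "('v::ab_group_add \<Rightarrow> 'v \<Rightarrow> 'f::field) \<Rightarrow> bool" where
  "nonisotropic b \<longleftrightarrow> (\<forall>x. x \<noteq> 0 \<longrightarrow> b x x \<noteq> 0)"

definition orthogonal_of :: "('v \<Rightarrow> 'v \<Rightarrow> 'f::field) \<Rightarrow> 'v set \<Rightarrow> 'v set" where
  "orthogonal_of s W = {y. \<forall>x\<in>W. s x y = 0}"

definition nondegenerate :: "('v::ab_group_add \<Rightarrow> 'v \<Rightarrow> 'f::field) \<Rightarrow> bool" where
  "nondegenerate s \<longleftrightarrow> orthogonal_of s UNIV = {0}"

definition symplectic_forms ::
    "('f::field \<Rightarrow> 'v::ab_group_add \<Rightarrow> 'v) \<Rightarrow> ('v \<Rightarrow> 'v \<Rightarrow> 'f) set" where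
  "symplectic_forms sc = {s \<in> alternating_forms sc. nondegenerate s}"


section \<open>Affine subspaces of the space of alternating forms\<close>

definition affine_subspace :: "('f::field \<Rightarrow> 'b::ab_group_add \<Rightarrow> 'b) \<Rightarrow> 'b set \<Rightarrow> bool" where
  "affine_subspace sc X \<longleftrightarrow> (\<exists>p U. module.subspace sc U \<and> X = (+) p ` U)"

text \<open>The set of differences is the translation vector space of a (nonempty) affine subspace.\<close>

definition affine_dimension :: "('f::field \<Rightarrow> 'b::ab_group_add \<Rightarrow> 'b) \<Rightarrow> 'b set \<Rightarrow> nat" where
  "affine_dimension sc X = vector_space.dim sc {p - q | p q. p \<in> X \<and> q \<in> X}"

definition symplectic_affine_subspace ::
    "('f::field \<Rightarrow> 'v::ab_group_add \<Rightarrow> 'v) \<Rightarrow> ('v \<Rightarrow> 'v \<Rightarrow> 'f) set \<Rightarrow> bool" where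
  "symplectic_affine_subspace sc X \<longleftrightarrow>
     affine_subspace form_scale X \<and> X \<subseteq> alternating_forms sc \<and> (\<forall>s\<in>X. nondegenerate s)"

definition optimal_symplectic_affine_subspace ::
    "('f::field \<Rightarrow> 'v::ab_group_add \<Rightarrow> 'v) \<Rightarrow> ('v \<Rightarrow> 'v \<Rightarrow> 'f) set \<Rightarrow> bool" where
  "optimal_symplectic_affine_subspace sc X \<longleftrightarrow>
     symplectic_affine_subspace sc X \<and>
     (\<forall>Y. symplectic_affine_subspace sc Y \<longrightarrow>
          affine_dimension form_scale Y \<le> affine_dimension form_scale X)"

definition irreducible_symplectic_set ::
    "('f::field \<Rightarrow> 'v::ab_group_add \<Rightarrow> 'v) \<Rightarrow> ('v \<Rightarrow> 'v \<Rightarrow> 'f) set \<Rightarrow> bool" where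
  "irreducible_symplectic_set sc X \<longleftrightarrow>
     X \<noteq> {} \<and> X \<subseteq> symplectic_forms sc \<and>
     \<not> (\<exists>W. module.subspace sc W \<and> W \<noteq> {0} \<and>
            (\<forall>s\<in>X. W \<subseteq> orthogonal_of s W) \<and>
            (\<forall>s\<in>X. \<forall>t\<in>X. orthogonal_of s W = orthogonal_of t W))"


section \<open>Quadratic extensions inside the endomorphism algebra\<close>

definition endomorphisms ::
    "('f::field \<Rightarrow> 'v::ab_group_add \<Rightarrow> 'v) \<Rightarrow> ('v \<Rightarrow> 'v) set" where
  "endomorphisms sc = {f. Vector_Spaces.linear sc sc f}"

definition endo_ring :: "('v::ab_group_add \<Rightarrow> 'v) set \<Rightarrow> ('v \<Rightarrow> 'v) ring" where
  "endo_ring L = \<lparr>carrier = L, mult = (\<circ>), one = id, zero = 0, add = (+)\<rparr>"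

text \<open>
  The field axioms for \<open>endo_ring L\<close> contain closure under composition and \<open>id \<in> L\<close>; together with
  the subspace condition this makes \<open>L\<close> a subalgebra containing the scalar multiples of \<open>id\<close>.
\<close>

definition quadratic_extension ::
    "('f::field \<Rightarrow> 'v::ab_group_add \<Rightarrow> 'v) \<Rightarrow> ('v \<Rightarrow> 'v) set \<Rightarrow> bool" where
  "quadratic_extension sc L \<longleftrightarrow>
     L \<subseteq> endomorphisms sc \<and>
     module.subspace (fun_scale sc) L \<and>
     Ring.field (endo_ring L) \<and>
     vector_space.dim (fun_scale sc) L = 2"

text \<open>The algebra \<open>F[a]\<close> of polynomials in \<open>a\<close>, as the span of the powers of \<open>a\<close>.\<close>

definition generated_algebra ::
    "('f::field \<Rightarrow> 'v::ab_group_add \<Rightarrow> 'v) \<Rightarrow> ('v \<Rightarrow> 'v) \<Rightarrow> ('v \<Rightarrow> 'v) set" where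
  "generated_algebra sc a = module.span (fun_scale sc) (range (\<lambda>k::nat. a ^^ k))"

definition W_space ::
    "('f::field \<Rightarrow> 'v::ab_group_add \<Rightarrow> 'v) \<Rightarrow> ('v \<Rightarrow> 'v) set \<Rightarrow> ('v \<Rightarrow> 'v \<Rightarrow> 'f) set" where
  "W_space sc L = {s. bilinear_form sc s \<and> (\<forall>x. \<forall>l\<in>L. s x (l x) = 0)}"

end

(* Upper bound: let s + U be a set of alternating forms that are nondegenerate on a space of
   dimension 2n.  The partners of a vector x are the z orthogonal to x such that the rank two form
   s(x,.) /\ s(z,.) belongs to U.  If u(x,z) = 0 for all u in U and all partners z of x, then 2n - 2
   linear conditions on u in U make u(x,.) vanish and make u determined by its restriction to a
   complement of x in the orthogonal of x, on which s + u is again nondegenerate; induction gives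
   dim U <= n(n-1).  Such an x exists over every field: over a finite one a count produces an x
   without partners outside its own line, over an infinite one every x is suitable because a
   certain polynomial vanishes at all nonzero scalars.

   Lower bound: for functionals F, G : V -> L that are L-linear, the two coordinates of
   F(x) G(y) - F(y) G(x) in the basis 1, a of L belong to W_L, and an L-basis of V yields n(n-1)
   independent such forms.  They also separate vectors that are L-independent, which gives
   irreducibility.  Nondegeneracy is immediate from (s0 + w)(x, a x) = s0(x, a x). *)

theory Submission
  imports Defs "HOL-Computational_Algebra.Polynomial"
begin

section \<open>Kernels of functionals and alternating forms\<close>

interpretation form: vector_space "form_scale :: 'f::field \<Rightarrow> ('v \<Rightarrow> 'v \<Rightarrow> 'f) \<Rightarrow> 'v \<Rightarrow> 'v \<Rightarrow> 'f"
  by (rule vector_space_form_scale)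

lemma form_scale_apply [simp]: "form_scale c s x y = c * s x y"
  by (simp add: fun_scale_def)

lemma form_subspaceI:
  assumes "0 \<in> U" "\<And>u v. u \<in> U \<Longrightarrow> v \<in> U \<Longrightarrow> u + v \<in> U" "\<And>c u. u \<in> U \<Longrightarrow> form_scale c u \<in> U"
  shows "form.subspace U"
  using assms by (simp add: form.subspace_def)

lemma vector_space_mult: "vector_space ((*) :: 'f::field \<Rightarrow> 'f \<Rightarrow> 'f)"
  by unfold_locales (auto simp: algebra_simps)

lemma (in vector_space) linear_functional_iff:
  "Vector_Spaces.linear scale (*) f \<longleftrightarrow> (\<forall>x y. f (x + y) = f x + f y) \<and> (\<forall>c x. f (scale c x) = c * f x)"
  by (simp add: Vector_Spaces.linear_iff vector_space_axioms vector_space_mult)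

lemma (in vector_space) bilinear_form_iff:
  "bilinear_form scale b \<longleftrightarrow>
     (\<forall>x y z. b (x + y) z = b x z + b y z) \<and> (\<forall>c x z. b (scale c x) z = c * b x z) \<and>
     (\<forall>x y z. b z (x + y) = b z x + b z y) \<and> (\<forall>c x z. b z (scale c x) = c * b z x)"
  unfolding bilinear_form_def linear_functional_iff by blast

context vector_space begin

lemma functional_zero: "Vector_Spaces.linear scale (*) f \<Longrightarrow> f 0 = 0"
  using linear_functional_iff[THEN iffD1, THEN conjunct2, rule_format, of f 0 0] by simp

lemma functional_diff: "Vector_Spaces.linear scale (*) f \<Longrightarrow> f (x - y) = f x - f y"
  using linear_functional_iff[THEN iffD1, THEN conjunct1, rule_format, of f "x - y" y]
  by simp

lemma functional_sum:
  assumes "Vector_Spaces.linear scale (*) f"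
  shows "f (sum g A) = (\<Sum>i\<in>A. f (g i))"
  using assms functional_zero[OF assms]
  by (induction A rule: infinite_finite_induct) (auto simp: linear_functional_iff)

lemma functional_eq_zero_on_span:
  assumes "Vector_Spaces.linear scale (*) f" "\<And>b. b \<in> B \<Longrightarrow> f b = 0" "x \<in> span B"
  shows "f x = 0"
  using assms(3)
proof (induction rule: span_induct_alt)
  case base
  then show ?case using functional_zero[OF assms(1)] .
next
  case (step c x y)
  then show ?case using assms(1,2) by (simp add: linear_functional_iff)
qed

lemma subspace_functional_kernel:
  assumes "subspace Z" "Vector_Spaces.linear scale (*) f"
  shows "subspace {z\<in>Z. f z = 0}"
  using assms functional_zero[OF assms(2)] by (auto simp: subspace_def linear_functional_iff)

text \<open>Subtracting a multiple of one \<open>u0\<close> with \<open>f u0 \<noteq> 0\<close>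
  lands in the kernel, so one extra generator suffices. Finite spanning sets replace dimensions
  because the space of all functions \<open>'v \<Rightarrow> 'v \<Rightarrow> 'f\<close> may have
  infinite dimension.\<close>

lemma span_insert_kernel:
  assumes "subspace U" "Vector_Spaces.linear scale (*) f"
    and "{u\<in>U. f u = 0} \<subseteq> span B" "finite B" "card B \<le> k"
  obtains B' where "finite B'" "card B' \<le> Suc k" "U \<subseteq> span B'"
proof (cases "\<exists>u0\<in>U. f u0 \<noteq> 0")
  case False
  then have "U \<subseteq> span B" using assms(3) by auto
  then show thesis using that[of B] assms by simp
next
  case True
  then obtain u0 where u0: "u0 \<in> U" "f u0 \<noteq> 0" by blast
  have "u \<in> span (insert u0 B)" if u: "u \<in> U" for u
  proof -
    let ?v = "u - scale (f u / f u0) u0"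
    have "f ?v = 0"
      using u0 assms(2) functional_diff[OF assms(2)] by (simp add: linear_functional_iff)
    moreover have "?v \<in> U" using u u0 assms(1) by (simp add: subspace_diff subspace_scale)
    ultimately show ?thesis using assms(3) span_insert by blast
  qed
  moreover have "card (insert u0 B) \<le> Suc k"
    using assms(4,5) card_insert_le_m1 by (simp add: card_insert_if)
  ultimately show thesis using that[of "insert u0 B"] assms(4) by blast
qed

lemma span_common_kernel:
  assumes "finite I" "subspace U" "\<And>i. i \<in> I \<Longrightarrow> Vector_Spaces.linear scale (*) (f i)"
    and "{u\<in>U. \<forall>i\<in>I. f i u = 0} \<subseteq> span B" "finite B" "card B \<le> k"
  obtains B' where "finite B'" "card B' \<le> k + card I" "U \<subseteq> span B'"
  using assms
proof (induction I arbitrary: U thesis rule: finite_induct)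
  case empty
  then show ?case by auto
next
  case (insert j I)
  let ?U = "{u\<in>U. f j u = 0}"
  have sub: "subspace ?U" using insert.prems subspace_functional_kernel by simp
  have eq: "{u\<in>?U. \<forall>i\<in>I. f i u = 0} = {u\<in>U. \<forall>i\<in>insert j I. f i u = 0}" by auto
  obtain B' where "finite B'" "card B' \<le> k + card I" "?U \<subseteq> span B'"
    by (rule insert.IH[of ?U]) (use insert.prems sub eq in \<open>auto\<close>)
  then obtain B'' where "finite B''" "card B'' \<le> Suc (k + card I)" "U \<subseteq> span B''"
    using span_insert_kernel[of U "f j" B' "k + card I"] insert.prems by auto
  then show ?case using insert.prems(1)[of B''] insert.hyps by simp
qed

end

section \<open>Alternating bilinear forms\<close>

locale alternating_form = vector_space scale
  for scale :: "'f::field \<Rightarrow> 'v::ab_group_add \<Rightarrow> 'v" +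
  fixes s :: "'v \<Rightarrow> 'v \<Rightarrow> 'f"
  assumes alternating: "s \<in> alternating_forms scale"
begin

lemma bilinear: "bilinear_form scale s"
  using alternating by (simp add: alternating_forms_def)

lemma self [simp]: "s x x = 0"
  using alternating by (simp add: alternating_forms_def)

lemma add_left: "s (x + y) z = s x z + s y z"
  and add_right: "s z (x + y) = s z x + s z y"
  and scale_left: "s (scale c x) z = c * s x z"
  and scale_right: "s z (scale c x) = c * s z x"
  using bilinear by (auto simp: bilinear_form_iff)

lemma linear_right: "Vector_Spaces.linear scale (*) (s x)"
  and linear_left: "Vector_Spaces.linear scale (*) (\<lambda>y. s y x)"
  using bilinear by (auto simp: bilinear_form_def)

lemma zero_left [simp]: "s 0 x = 0" and zero_right [simp]: "s x 0 = 0"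
  using functional_zero[OF linear_left] functional_zero[OF linear_right] by auto

lemma diff_left: "s (x - y) z = s x z - s y z" and diff_right: "s z (x - y) = s z x - s z y"
  using functional_diff[OF linear_left] functional_diff[OF linear_right] by auto

lemma sum_left: "s (sum g A) z = (\<Sum>i\<in>A. s (g i) z)"
  using functional_sum[OF linear_left] .

lemma skew: "s x y = - s y x"
proof -
  have "s (x + y) (x + y) = 0" by (rule self)
  then show ?thesis unfolding add_left add_right by (simp add: eq_neg_iff_add_eq_0 add.commute)
qed

lemmas simps = add_left add_right scale_left scale_right diff_left diff_right

end

lemma (in vector_space) alternating_formI: "s \<in> alternating_forms scale \<Longrightarrow> alternating_form scale s"
  by (simp add: alternating_form_def alternating_form_axioms_def vector_space_axioms)

lemma (in vector_space) alternating_forms_subspace: "form.subspace (alternating_forms scale)"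
  by (intro form_subspaceI) (auto simp: alternating_forms_def bilinear_form_iff algebra_simps)

lemma (in vector_space) linear_evaluation:
  "Vector_Spaces.linear form_scale (*) (\<lambda>u::'v\<Rightarrow>'v\<Rightarrow>'w::field. u x y)"
  by (simp add: form.linear_functional_iff)

section \<open>Pencils of symplectic forms\<close>

text \<open>On \<open>P\<close> the kernel of \<open>f\<close> has codimension at most one, so a
  single vector \<open>r\<close> outside it fixes the factor.\<close>

lemma (in vector_space) functional_multiple:
  assumes "subspace P" "Vector_Spaces.linear scale (*) f" "Vector_Spaces.linear scale (*) g"
    and "\<And>q. q \<in> P \<Longrightarrow> f q = 0 \<Longrightarrow> g q = 0"
  obtains c where "\<And>q. q \<in> P \<Longrightarrow> g q = c * f q"
proof (cases "\<exists>r\<in>P. f r \<noteq> 0")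
  case False
  then show thesis using that[of 0] assms(4) by auto
next
  case True
  then obtain r where r: "r \<in> P" "f r \<noteq> 0" by blast
  have "g q = (g r / f r) * f q" if q: "q \<in> P" for q
  proof -
    let ?v = "q - scale (f q / f r) r"
    have "?v \<in> P" using q r assms(1) by (simp add: subspace_diff subspace_scale)
    moreover have "f ?v = 0"
      using r assms(2) functional_diff[OF assms(2)] by (simp add: linear_functional_iff)
    ultimately have "g ?v = 0" by (rule assms(4))
    then show ?thesis
      using assms(3) functional_diff[OF assms(3)] by (simp add: linear_functional_iff mult.commute)
  qed
  then show thesis using that by blast
qed

section \<open>Dimension counts for kernels of functionals\<close>

context finite_dimensional_vector_space begin

lemma common_kernel_nonzero:
  assumes "subspace P" "finite I" "card I < dim P"
    and "\<And>i. i \<in> I \<Longrightarrow> Vector_Spaces.linear scale (*) (f i)"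
  obtains z where "z \<in> P" "z \<noteq> 0" "\<And>i. i \<in> I \<Longrightarrow> f i z = 0"
proof (rule ccontr)
  assume "\<not> thesis"
  then have "{z\<in>P. \<forall>i\<in>I. f i z = 0} \<subseteq> span {}" using that by auto
  then obtain B where B: "finite B" "card B \<le> 0 + card I" "P \<subseteq> span B"
    using span_common_kernel[of I P f "{}" 0] assms by (auto intro: that)
  then show False using dim_le_card[OF B(3,1)] assms(3) by simp
qed

lemma dim_kernel:
  assumes "subspace P" "Vector_Spaces.linear scale (*) f" "r \<in> P" "f r \<noteq> 0"
  shows "dim P = Suc (dim {q\<in>P. f q = 0})"
proof (rule antisym)
  let ?N = "{q\<in>P. f q = 0}"
  have sub: "subspace ?N" using subspace_functional_kernel assms by blast
  obtain B where B: "B \<subseteq> ?N" "independent B" "?N \<subseteq> span B" "card B = dim ?N" by (rule basis_exists)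
  obtain B' where B': "finite B'" "card B' \<le> Suc (dim ?N)" "P \<subseteq> span B'"
    by (rule span_insert_kernel[of P f B "dim ?N"]) (use B assms finiteI_independent in auto)
  then show "dim P \<le> Suc (dim ?N)" using dim_le_card[OF B'(3,1)] by simp
  have "?N \<subset> P" using assms by auto
  then have "dim ?N < dim P" by (intro dim_psubset) (use sub assms in \<open>simp add: span_eq_iff[THEN iffD2]\<close>)
  then show "Suc (dim ?N) \<le> dim P" by simp
qed

text \<open>Greedy choice: a functional that is nonzero on the current kernel lowers its dimension
  by exactly one, so the choice stops after at most as many steps as the common kernel has
  codimension.\<close>

lemma finite_test_functionals:
  assumes "subspace Z" "\<And>h. h \<in> H \<Longrightarrow> Vector_Spaces.linear scale (*) (f h)"
  obtains C where "finite C" "C \<subseteq> H" "card C + dim {z\<in>Z. \<forall>h\<in>H. f h z = 0} \<le> dim Z"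
    "{z\<in>Z. \<forall>h\<in>C. f h z = 0} = {z\<in>Z. \<forall>h\<in>H. f h z = 0}"
  using assms(1)
proof (induction "dim Z" arbitrary: Z thesis rule: less_induct)
  case less
  show ?case
  proof (cases "\<exists>h\<in>H. \<exists>z\<in>Z. f h z \<noteq> 0")
    case False
    then have "{z\<in>Z. \<forall>h\<in>H. f h z = 0} = Z" by auto
    then show ?thesis using less.prems(1)[of "{}"] by auto
  next
    case True
    then obtain h r where h: "h \<in> H" "r \<in> Z" "f h r \<noteq> 0" by blast
    let ?N = "{z\<in>Z. f h z = 0}"
    have dim: "dim Z = Suc (dim ?N)" using dim_kernel[of Z "f h" r] h less.prems(2) assms(2) by blast
    have sub: "subspace ?N" using subspace_functional_kernel h less.prems(2) assms(2) by blast
    obtain C where C: "finite C" "C \<subseteq> H" "card C + dim {z\<in>?N. \<forall>h\<in>H. f h z = 0} \<le> dim ?N"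
      "{z\<in>?N. \<forall>h\<in>C. f h z = 0} = {z\<in>?N. \<forall>h\<in>H. f h z = 0}"
      using less.hyps[of ?N] dim sub by auto
    have eq: "{z\<in>?N. \<forall>h\<in>H. f h z = 0} = {z\<in>Z. \<forall>h\<in>H. f h z = 0}" using h by auto
    have eq2: "{z\<in>?N. \<forall>h\<in>C. f h z = 0} = {z\<in>Z. \<forall>k\<in>insert h C. f k z = 0}" by auto
    show ?thesis
    proof (rule less.prems(1)[of "insert h C"])
      show "card (insert h C) + dim {z\<in>Z. \<forall>h\<in>H. f h z = 0} \<le> dim Z"
        using C dim unfolding eq by (simp add: card_insert_if)
      show "{z\<in>Z. \<forall>k\<in>insert h C. f k z = 0} = {z\<in>Z. \<forall>h\<in>H. f h z = 0}"
        using C(4) unfolding eq eq2 .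
    qed (use C h in auto)
  qed
qed

lemma finite_span:
  assumes "finite (UNIV :: 'a set)" "finite B"
  shows "finite (span B)"
  using assms(2)
proof induction
  case (insert b B)
  have "span (insert b B) \<subseteq> (\<Union>k. (\<lambda>y. y + scale k b) ` span B)"
  proof
    fix x assume "x \<in> span (insert b B)"
    then obtain k where "x - scale k b \<in> span B" using span_breakdown_eq by blast
    then have "x \<in> (\<lambda>y. y + scale k b) ` span B" by (intro image_eqI[of _ _ "x - scale k b"]) auto
    then show "x \<in> (\<Union>k. (\<lambda>y. y + scale k b) ` span B)" by blast
  qed
  then show ?case using insert assms(1) by (auto intro: finite_subset)
qed simp

end

text \<open>All forms stay defined on the whole space and only the test space \<open>P\<close>
  shrinks, so the induction changes \<open>P\<close> and \<open>U\<close> without ever restricting a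
  form.\<close>

locale symplectic_pencil =
  finite_dimensional_vector_space scale Basis + alternating_form scale s
  for scale :: "'f::field \<Rightarrow> 'v::ab_group_add \<Rightarrow> 'v" and Basis s +
  fixes P :: "'v set" and U :: "('v \<Rightarrow> 'v \<Rightarrow> 'f) set"
  assumes subspace_P: "subspace P"
    and subspace_U: "form.subspace U"
    and U_alternating: "U \<subseteq> alternating_forms scale"
    and nondegenerate: "\<And>u w. u \<in> U \<Longrightarrow> w \<in> P \<Longrightarrow> (\<And>q. q \<in> P \<Longrightarrow> s w q + u w q = 0) \<Longrightarrow> w = 0"
begin

lemma nondegenerate_base:
  assumes "w \<in> P" "\<And>q. q \<in> P \<Longrightarrow> s w q = 0"
  shows "w = 0"
  using nondegenerate[of 0 w] form.subspace_0[OF subspace_U] assms by simp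

lemma nondegenerate_combination:
  assumes "u \<in> U" "v \<in> U" "w \<in> P" "\<And>q. q \<in> P \<Longrightarrow> s w q + (c * u w q + d * v w q) = 0"
  shows "w = 0"
  by (rule nondegenerate[of "form_scale c u + form_scale d v" w])
    (use assms subspace_U in \<open>auto simp: form.subspace_add form.subspace_scale\<close>)

lemma U_form: "u \<in> U \<Longrightarrow> alternating_form scale u"
  using U_alternating alternating_formI by blast

text \<open>A dimension count gives a nonzero \<open>z\<close> orthogonal to the kernel of
  \<open>g\<close>; then \<open>s z\<close> is a nonzero multiple of \<open>g\<close> on
  \<open>P\<close>, and \<open>z\<close> can be rescaled.\<close>

lemma representable:
  assumes g: "Vector_Spaces.linear scale (*) g"
  obtains z where "z \<in> P" "\<And>q. q \<in> P \<Longrightarrow> s z q = g q"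
proof (cases "\<exists>r\<in>P. g r \<noteq> 0")
  case False
  then show thesis using that[of 0] subspace_0[OF subspace_P] by simp
next
  case True
  let ?N = "{q\<in>P. g q = 0}"
  have dim: "dim P = Suc (dim ?N)" using True dim_kernel[OF subspace_P g] by blast
  obtain B where B: "B \<subseteq> ?N" "independent B" "?N \<subseteq> span B" "card B = dim ?N" by (rule basis_exists)
  obtain z where z: "z \<in> P" "z \<noteq> 0" "\<And>b. b \<in> B \<Longrightarrow> s z b = 0"
    using common_kernel_nonzero[OF subspace_P, of B "\<lambda>b z. s z b"] B dim linear_left finiteI_independent
    by auto
  have "s z q = 0" if "q \<in> P" "g q = 0" for q
    using functional_eq_zero_on_span[OF linear_right z(3), of B q] that B(3) by auto
  then obtain c where c: "\<And>q. q \<in> P \<Longrightarrow> s z q = c * g q"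
    using functional_multiple[OF subspace_P g linear_right, of z] by blast
  then have "c \<noteq> 0" using nondegenerate_base[OF z(1)] z(2) by auto
  with z(1) c show thesis
    using that[of "scale (1 / c) z"] subspace_scale[OF subspace_P] by (simp add: simps)
qed

definition partners :: "'v \<Rightarrow> 'v set" where
  "partners x = {z\<in>P. s x z = 0 \<and> (\<exists>u\<in>U. \<forall>p\<in>P. \<forall>q\<in>P. u p q = s x p * s z q - s x q * s z p)}"

lemma partnersI:
  assumes "z \<in> P" "s x z = 0" "u \<in> U"
    and "\<And>p q. p \<in> P \<Longrightarrow> q \<in> P \<Longrightarrow> u p q = s x p * s z q - s x q * s z p"
  shows "z \<in> partners x"
  using assms unfolding partners_def by blast

lemma partnersE:
  assumes "z \<in> partners x"
  obtains u where "z \<in> P" "s x z = 0" "u \<in> U"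
    "\<And>p q. p \<in> P \<Longrightarrow> q \<in> P \<Longrightarrow> u p q = s x p * s z q - s x q * s z p"
  using assms unfolding partners_def by blast

lemma self_partner: "x \<in> P \<Longrightarrow> x \<in> partners x"
  by (rule partnersI[of _ _ 0]) (simp_all add: form.subspace_0[OF subspace_U])

lemma partners_subspace: "subspace (partners x)"
  unfolding subspace_def
proof (intro conjI allI impI ballI)
  show "0 \<in> partners x"
    by (rule partnersI[of _ _ 0])
      (simp_all add: form.subspace_0[OF subspace_U] subspace_0[OF subspace_P])
next
  fix y z assume "y \<in> partners x" "z \<in> partners x"
  then obtain u v where *: "y \<in> P" "s x y = 0" "u \<in> U" "z \<in> P" "s x z = 0" "v \<in> U"
    "\<And>p q. p \<in> P \<Longrightarrow> q \<in> P \<Longrightarrow> u p q = s x p * s y q - s x q * s y p"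
    "\<And>p q. p \<in> P \<Longrightarrow> q \<in> P \<Longrightarrow> v p q = s x p * s z q - s x q * s z p"
    by (metis partnersE)
  show "y + z \<in> partners x"
    by (rule partnersI[of _ _ "u + v"])
      (simp_all add: * subspace_add[OF subspace_P] form.subspace_add[OF subspace_U] simps algebra_simps)
next
  fix c z assume "z \<in> partners x"
  then obtain v where *: "z \<in> P" "s x z = 0" "v \<in> U"
    "\<And>p q. p \<in> P \<Longrightarrow> q \<in> P \<Longrightarrow> v p q = s x p * s z q - s x q * s z p"
    by (metis partnersE)
  show "scale c z \<in> partners x"
    by (rule partnersI[of _ _ "form_scale c v"])
      (simp_all add: * subspace_scale[OF subspace_P] form.subspace_scale[OF subspace_U] simps algebra_simps)
qed

end

lemma (in vector_space) in_span_image_lessThan: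
  assumes "x \<in> span (a ` {..<m::nat})"
  obtains c where "x = (\<Sum>i<m. scale (c i) (a i))"
  using assms
proof (induction m arbitrary: x thesis)
  case 0
  then show ?case by simp
next
  case (Suc m)
  then obtain k where "x - scale k (a m) \<in> span (a ` {..<m})"
    by (metis lessThan_Suc image_insert span_breakdown_eq)
  then obtain c where c: "x - scale k (a m) = (\<Sum>i<m. scale (c i) (a i))" using Suc.IH by blast
  have "x = (\<Sum>i<Suc m. scale ((c(m := k)) i) (a i))"
    using c by (simp add: algebra_simps)
  then show ?case by (rule Suc.prems(1))
qed

text \<open>Otherwise arbitrarily long initial segments would be independent. The value
  \<open>m = 0\<close> is possible and means that the first term is zero.\<close>

lemma (in finite_dimensional_vector_space) sequence_dependency:
  fixes a :: "nat \<Rightarrow> 'b"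
  obtains m where "a m \<in> span (a ` {..<m})"
proof (rule ccontr)
  assume "\<not> thesis"
  then have a: "a m \<notin> span (a ` {..<m})" for m using that by blast
  have "independent (a ` {..<m}) \<and> card (a ` {..<m}) = m" for m
  proof (induction m)
    case (Suc m)
    then show ?case
      using a[of m] span_base[of "a m" "a ` {..<m}"]
      by (auto simp: lessThan_Suc independent_insert card_insert_if)
  qed (simp add: independent_empty)
  from this[of "Suc (dim UNIV)"] show False
    using independent_card_le_dim[of "a ` {..<Suc (dim UNIV)}" UNIV] by simp
qed

section \<open>Vectors orthogonal to their partners under the whole pencil\<close>

context symplectic_pencil begin

text \<open>Let \<open>u\<close> and \<open>v\<close> be the rank two forms of the two partners. If
  both \<open>s y r\<close> and \<open>s z p\<close> were nonzero, \<open>u / s y r\<close> would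
  send \<open>p + r\<close> to \<open>- s p\<close> and \<open>v / s z p\<close> would send it to
  \<open>- s r\<close>, so \<open>p + r\<close> would be in the radical of a member of the
  pencil.\<close>

lemma no_partner_two_cycle:
  assumes "p \<in> P" "r \<in> P" "s p r = 0" "y \<in> partners p" "z \<in> partners r" "s y r \<noteq> 0"
  shows "s z p = 0"
proof (rule ccontr)
  assume nz: "s z p \<noteq> 0"
  obtain u where u: "s p y = 0" "u \<in> U"
    "\<And>p' q. p' \<in> P \<Longrightarrow> q \<in> P \<Longrightarrow> u p' q = s p p' * s y q - s p q * s y p'"
    by (rule partnersE[OF assms(4)]) blast
  obtain v where v: "s r z = 0" "v \<in> U"
    "\<And>p' q. p' \<in> P \<Longrightarrow> q \<in> P \<Longrightarrow> v p' q = s r p' * s z q - s r q * s z p'"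
    by (rule partnersE[OF assms(5)]) blast
  have zero: "s y p = 0" "s z r = 0" "s r p = 0"
    using u(1) v(1) assms(3) skew[of y p] skew[of z r] skew[of r p] by auto
  have pr: "p + r \<in> P" using assms subspace_add[OF subspace_P] by blast
  have "p + r = 0"
    by (rule nondegenerate_combination[OF u(2) v(2) pr, of "1 / s y r" "1 / s z p"])
      (use u(3)[OF pr] v(3)[OF pr] zero assms(3,6) nz in \<open>simp add: simps field_simps\<close>)
  then have "r = - p" by (simp add: eq_neg_iff_add_eq_0 add.commute)
  then have "s y r = - s y p" using diff_right[of y 0 p] by simp
  with zero assms(6) show False by simp
qed

text \<open>This is the double orthogonal of a line: equal kernels make \<open>s z\<close> a
  multiple of \<open>s x\<close> on \<open>P\<close>, and nondegeneracy transfers the factor to the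
  vectors.\<close>

lemma orthogonal_complement_line:
  assumes "x \<in> P" "z \<in> P" "\<And>q. q \<in> P \<Longrightarrow> s x q = 0 \<Longrightarrow> s z q = 0"
  shows "z \<in> span {x}"
proof -
  obtain c where c: "\<And>q. q \<in> P \<Longrightarrow> s z q = c * s x q"
    using functional_multiple[OF subspace_P linear_right linear_right, of x z] assms(3) by blast
  have "z - scale c x = 0"
    by (rule nondegenerate_base)
      (use c assms subspace_P in \<open>simp_all add: simps subspace_diff subspace_scale\<close>)
  then show ?thesis by (auto simp: span_singleton)
qed

text \<open>
  Otherwise choose a partner of every vector \<open>p\<close> outside the line of \<open>p\<close>. More than half of the
  vectors orthogonal to \<open>p\<close> are not orthogonal to its partner, so that two vectors would be in
  this relation in both directions.
\<close>
lemma finite_field_trivial_partners: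
  assumes fin: "finite (UNIV :: 'f set)" and "dim P \<noteq> 0"
  obtains x where "x \<in> P" "x \<noteq> 0" "partners x \<subseteq> span {x}"
proof (rule ccontr)
  assume "\<not> thesis"
  then have "\<forall>x\<in>P - {0}. \<exists>z. z \<in> partners x \<and> z \<notin> span {x}" using that by blast
  then obtain f where f: "\<And>x. x \<in> P \<Longrightarrow> x \<noteq> 0 \<Longrightarrow> f x \<in> partners x \<and> f x \<notin> span {x}"
    by (metis DiffI singletonD)
  have finP: "finite P"
  proof -
    obtain B where B: "B \<subseteq> P" "independent B" "P \<subseteq> span B" by (rule maximal_independent_subset)
    then show ?thesis using finite_span[OF fin] finiteI_independent finite_subset by metis
  qed
  define E where "E = Sigma (P - {0}) (\<lambda>p. {r\<in>P - {0}. s p r = 0})"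
  define G where "G = Sigma (P - {0}) (\<lambda>p. {r\<in>P - {0}. s p r = 0 \<and> s (f p) r \<noteq> 0})"
  have finE: "finite E" "finite G" using finP by (auto simp: E_def G_def)
  have half: "card {r\<in>P - {0}. s p r = 0} < 2 * card {r\<in>P - {0}. s p r = 0 \<and> s (f p) r \<noteq> 0}"
    (is "card ?O < 2 * card ?G") if p: "p \<in> P - {0}" for p
  proof -
    let ?N = "{r\<in>P. s p r = 0 \<and> s (f p) r = 0}"
    have "f p \<in> P" "f p \<notin> span {p}" using f p by (auto simp: partners_def)
    then obtain r where r: "r \<in> P" "s p r = 0" "s (f p) r \<noteq> 0"
      using orthogonal_complement_line[of p "f p"] p by blast
    \<comment> \<open>Translation by \<open>r\<close> moves the subspace \<open>?N\<close> off
      itself, injectively into \<open>?G\<close>.\<close>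
    have "r + y \<noteq> 0" if "y \<in> ?N" for y
      using that r(3) add_right[of "f p" r y] by auto
    then have "(+) r ` ?N \<subseteq> ?G"
      using r subspace_add[OF subspace_P] by (auto simp: simps)
    then have le: "card ?N \<le> card ?G"
      using finP card_mono[of ?G "(+) r ` ?N"] by (simp add: card_image)
    \<comment> \<open>The zero vector counts in \<open>?N\<close> but not in \<open>?O\<close>; this
      surplus of one makes the inequality strict.\<close>
    have "insert 0 ?O = ?N \<union> ?G" "?N \<inter> ?G = {}" using subspace_0[OF subspace_P] by auto
    then have "Suc (card ?O) = card ?N + card ?G"
      using finP card_Un_disjoint[of ?N ?G] card_insert_disjoint[of ?O 0] by simp
    with le show ?thesis by linarith
  qed
  have "card E = (\<Sum>p\<in>P - {0}. card {r\<in>P - {0}. s p r = 0})"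
    unfolding E_def using finP by (simp add: card_SigmaI)
  also have "\<dots> < (\<Sum>p\<in>P - {0}. 2 * card {r\<in>P - {0}. s p r = 0 \<and> s (f p) r \<noteq> 0})"
  proof (rule sum_strict_mono)
    have "\<not> P \<subseteq> {0}" using assms(2) by simp
    then show "P - {0} \<noteq> {}" by blast
  qed (use finP half in auto)
  also have "\<dots> = 2 * card G"
    unfolding G_def sum_distrib_left[symmetric] using finP by (simp add: card_SigmaI)
  finally have lt: "card E < card G + card (prod.swap ` G)" by (simp add: card_image)
  have "s r p = 0" if "s p r = 0" for p r using that skew[of r p] by simp
  then have "G \<subseteq> E" "prod.swap ` G \<subseteq> E" by (auto simp: E_def G_def)
  then have "card (G \<union> prod.swap ` G) \<le> card E" using finE by (intro card_mono) auto
  then have "G \<inter> prod.swap ` G \<noteq> {}"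
    using lt finE card_Un_disjoint[of G "prod.swap ` G"] by fastforce
  then obtain p r where "(p, r) \<in> G" "(r, p) \<in> G" by auto
  then have "p \<in> P" "r \<in> P" "p \<noteq> 0" "r \<noteq> 0" "s p r = 0" "s (f p) r \<noteq> 0" "s (f r) p \<noteq> 0"
    by (auto simp: G_def)
  then show False using no_partner_two_cycle[of p r "f p" "f r"] f by blast
qed

text \<open>Let \<open>A\<close> represent \<open>v\<close> through \<open>s\<close> on
  \<open>P\<close>, and let \<chi> be a monic polynomial with \<chi>(A) z = 0. The vector (\<chi>(A)
  - \<chi>(\<mu>)) / (A - \<mu>) z is orthogonal to \<open>x\<close> for all nonzero \<mu>. As a
  polynomial identity in \<mu> this yields s(x, A z) = 0, which is the claim up to sign.\<close>

lemma infinite_field_partner_orthogonal: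
  assumes inf: "infinite (UNIV :: 'f set)" and x: "x \<in> P" and z: "z \<in> partners x" and v: "v \<in> U"
  shows "v x z = 0"
proof -
  interpret v: alternating_form scale v by (rule U_form[OF v])
  obtain u where u: "z \<in> P" "s x z = 0" "u \<in> U"
    "\<And>p q. p \<in> P \<Longrightarrow> q \<in> P \<Longrightarrow> u p q = s x p * s z q - s x q * s z p"
    by (rule partnersE[OF z]) blast
  have "\<exists>y'. y' \<in> P \<and> (\<forall>q\<in>P. s y' q = v y q)" for y
    using representable[OF v.linear_right, of y] by metis
  then obtain A where A: "\<And>y. A y \<in> P" "\<And>y q. q \<in> P \<Longrightarrow> s (A y) q = v y q" by metis
  define a where "a i = (A ^^ i) z" for i
  have aP: "a i \<in> P" for i by (cases i) (auto simp: a_def A u)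
  have a0: "a 0 = z" and aS: "q \<in> P \<Longrightarrow> s (a (Suc i)) q = v (a i) q" for i q
    by (auto simp: a_def A)
  obtain m where "a m \<in> span (a ` {..<m})" by (rule sequence_dependency)
  then obtain c where c: "a m = (\<Sum>i<m. scale (c i) (a i))" by (rule in_span_image_lessThan)
  \<comment> \<open>Horner form of (A^i - \<mu>^i) / (A - \<mu>) applied to \<open>z\<close>, that
    is, the sum of \<mu>^(i-1-j) \<open>a j\<close> over j < i.\<close>
  define h where "h \<mu> i = rec_nat 0 (\<lambda>i y. scale \<mu> y + a i) i" for \<mu> i
  have h0: "h \<mu> 0 = 0" and hS: "h \<mu> (Suc i) = scale \<mu> (h \<mu> i) + a i" for \<mu> i
    by (auto simp: h_def)
  have hP: "h \<mu> i \<in> P" for \<mu> i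
    by (induction i) (use h0 hS aP subspace_P in \<open>auto simp: subspace_0 subspace_add subspace_scale\<close>)
  have h_eq: "v (h \<mu> i) q - \<mu> * s (h \<mu> i) q = s (a i) q - \<mu> ^ i * s z q" if "q \<in> P" for \<mu> i q
  proof (induction i)
    case (Suc i)
    have "v (h \<mu> (Suc i)) q - \<mu> * s (h \<mu> (Suc i)) q
        = \<mu> * (v (h \<mu> i) q - \<mu> * s (h \<mu> i) q) + (v (a i) q - \<mu> * s (a i) q)"
      by (simp add: hS simps v.simps algebra_simps)
    also have "\<dots> = s (a (Suc i)) q - \<mu> ^ Suc i * s z q"
      unfolding Suc by (simp add: aS[OF that] algebra_simps)
    finally show ?case .
  qed (simp add: h0 a0)
  define w where "w \<mu> = h \<mu> m - (\<Sum>i<m. scale (c i) (h \<mu> i))" for \<mu>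
  have wP: "w \<mu> \<in> P" for \<mu>
    unfolding w_def using hP subspace_P by (auto intro!: subspace_diff subspace_sum subspace_scale)
  \<comment> \<open>\<open>d\<close> is the monic polynomial \<chi> that annihilates
    \<open>z\<close>; the next claim reads (A - \<mu>) \<open>w \<mu>\<close> = -
    \<open>d \<mu>\<close> \<open>z\<close>.\<close>
  define d where "d \<mu> = \<mu> ^ m - (\<Sum>i<m. c i * \<mu> ^ i)" for \<mu>
  have w_eq: "v (w \<mu>) q - \<mu> * s (w \<mu>) q = - d \<mu> * s z q" if q: "q \<in> P" for \<mu> q
  proof -
    have "v (w \<mu>) q - \<mu> * s (w \<mu>) q = (v (h \<mu> m) q - \<mu> * s (h \<mu> m) q)
        - (\<Sum>i<m. c i * (v (h \<mu> i) q - \<mu> * s (h \<mu> i) q))"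
      by (simp add: w_def simps v.simps sum_left v.sum_left algebra_simps sum_subtractf sum_distrib_left)
    also have "\<dots> = s (a m) q - \<mu> ^ m * s z q - (\<Sum>i<m. c i * (s (a i) q - \<mu> ^ i * s z q))"
      by (simp only: h_eq[OF q])
    also have "\<dots> = - d \<mu> * s z q"
      by (subst c) (simp add: simps sum_left d_def algebra_simps sum_subtractf sum_distrib_left)
    finally show ?thesis .
  qed
  have vanish: "s x (w \<mu>) = 0" if mu: "\<mu> \<noteq> 0" for \<mu>
  proof (rule ccontr)
    assume nz: "s x (w \<mu>) \<noteq> 0"
    define k where "k = d \<mu> / \<mu>"
    have eq: "s (w \<mu>) q - v (w \<mu>) q / \<mu> = k * s z q" if "q \<in> P" for q
      using w_eq[OF that, of \<mu>] mu by (simp add: k_def field_simps)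
    \<comment> \<open>Testing against \<open>w \<mu>\<close> itself kills the left side, since both
      forms are alternating. Hence the second term of \<open>u (w \<mu>) q\<close> disappears after
      multiplication by \<open>k\<close>, and a multiple of \<open>u\<close> cancels
      \<open>k * s z q\<close>.\<close>
    have "k * s z (w \<mu>) = 0" using eq[OF wP[of \<mu>]] by simp
    then have k: "k = 0 \<or> s z (w \<mu>) = 0" by simp
    have "w \<mu> = 0"
    proof (rule nondegenerate_combination[OF u(3) v wP])
      fix q assume q: "q \<in> P"
      have "s (w \<mu>) q = v (w \<mu>) q / \<mu> + k * s z q" using eq[OF q] by (simp add: algebra_simps)
      moreover have "k * u (w \<mu>) q / s x (w \<mu>) = k * s z q"
        using k nz by (auto simp: u(4)[OF wP q])
      ultimately show "s (w \<mu>) q + ((- k / s x (w \<mu>)) * u (w \<mu>) q + (- 1 / \<mu>) * v (w \<mu>) q) = 0"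
        by simp
    qed
    with nz show False by simp
  qed
  \<comment> \<open>The same Horner recursion, now as a polynomial in \<mu> whose values are
    \<open>s x (h \<mu> i)\<close>.\<close>
  define H where "H i = rec_nat 0 (\<lambda>i g. pCons (s x (a i)) g) i" for i
  have H0: "H 0 = 0" and HS: "H (Suc i) = pCons (s x (a i)) (H i)" for i by (auto simp: H_def)
  have poly_H: "poly (H i) \<mu> = s x (h \<mu> i)" for i \<mu>
    by (induction i) (simp_all add: H0 HS h0 hS simps)
  have coeff_H: "coeff (H i) k = (if k < i then s x (a (i - 1 - k)) else 0)" for i k
  proof (induction i arbitrary: k)
    case (Suc i)
    then show ?case by (cases k) (auto simp: HS)
  qed (simp add: H0)
  define Q where "Q = H m - (\<Sum>i<m. smult (c i) (H i))"
  have "poly Q \<mu> = s x (w \<mu>)" for \<mu>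
    by (simp add: Q_def w_def poly_sum poly_H simps functional_sum[OF linear_right])
  then have "UNIV - {0} \<subseteq> {\<mu>. poly Q \<mu> = 0}" using vanish by auto
  then have "Q = 0" using inf poly_roots_finite[of Q] by (meson finite_Diff2 finite.simps finite_subset)
  \<comment> \<open>This is read off the coefficient of degree \<open>m - 2\<close> of
    \<open>Q\<close>: \<open>H m\<close> contributes \<open>s x (a 1)\<close>,
    \<open>H (m - 1)\<close> a multiple of \<open>s x z = 0\<close>, and shorter ones nothing. For
    \<open>m < 2\<close> the vector \<open>a 1\<close> is itself zero or a multiple of
    \<open>z\<close>.\<close>
  have "s x (a 1) = 0"
  proof (cases "m \<ge> 2")
    case False
    then consider "m = 0" | "m = 1" by linarith
    then show ?thesis
    proof cases
      case 1
      then have "v z x = 0" "a 0 = 0" using c a0 by auto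
      then have "a 1 = 0" using nondegenerate_base[OF aP] aS[of _ 0] by simp
      then show ?thesis by simp
    next
      case 2
      then show ?thesis using c a0 u(2) by (simp add: simps)
    qed
  next
    case True
    have "coeff (H i) (m - 2) = 0" if "i < m" for i
    proof (cases "i = m - 1")
      case True
      then show ?thesis using \<open>m \<ge> 2\<close> a0 u(2) by (simp add: coeff_H)
    qed (use that in \<open>simp add: coeff_H\<close>)
    then have "coeff Q (m - 2) = coeff (H m) (m - 2)" by (simp add: Q_def coeff_sum)
    also have "\<dots> = s x (a 1)" using True by (simp add: coeff_H)
    finally show ?thesis using \<open>Q = 0\<close> by simp
  qed
  then have "v z x = 0" using aS[OF x, of 0] a0 skew[of x "a 1"] by simp
  then show ?thesis using v.skew[of x z] by simp
qed

end

section \<open>Reduction of the test space by two dimensions\<close>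

context symplectic_pencil begin

lemma exists_vector_orthogonal_to_partners:
  assumes "dim P \<noteq> 0"
  obtains x where "x \<in> P" "x \<noteq> 0" "\<And>z v. z \<in> partners x \<Longrightarrow> v \<in> U \<Longrightarrow> v x z = 0"
proof (cases "finite (UNIV :: 'f set)")
  case True
  then obtain x where x: "x \<in> P" "x \<noteq> 0" "partners x \<subseteq> span {x}"
    using finite_field_trivial_partners assms by blast
  have "v x z = 0" if "z \<in> partners x" "v \<in> U" for z v
  proof -
    interpret v: alternating_form scale v by (rule U_form[OF that(2)])
    from that x(3) show ?thesis by (auto simp: span_singleton v.simps)
  qed
  with x that show thesis by blast
next
  case False
  have "\<not> P \<subseteq> {0}" using assms by simp
  then obtain x where "x \<in> P" "x \<noteq> 0" by blast
  with False show thesis using that infinite_field_partner_orthogonal by blast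
qed

text \<open>
  The vector \<open>x\<close> makes the two costs of the reduction balance: making \<open>u x\<close> vanish takes
  \<open>dim P - 1 - dim (partners x)\<close> linear conditions on \<open>u\<close>, and excluding the
  forms that vanish on the orthogonal of \<open>x\<close> takes \<open>dim (partners x) - 1\<close> more.
\<close>
lemma reduction:
  assumes inj: "\<And>u. u \<in> U \<Longrightarrow> (\<And>p q. p \<in> P \<Longrightarrow> q \<in> P \<Longrightarrow> u p q = 0) \<Longrightarrow> u = 0"
    and dimP: "dim P = Suc (Suc d)"
  obtains P' U' where "symplectic_pencil scale Basis s P' U'" "dim P' = d"
    "\<And>u. u \<in> U' \<Longrightarrow> (\<And>p q. p \<in> P' \<Longrightarrow> q \<in> P' \<Longrightarrow> u p q = 0) \<Longrightarrow> u = 0"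
    "\<And>B k. finite B \<Longrightarrow> card B \<le> k \<Longrightarrow> U' \<subseteq> form.span B \<Longrightarrow>
       \<exists>B'. finite B' \<and> card B' \<le> k + d \<and> U \<subseteq> form.span B'"
proof -
  obtain x where x: "x \<in> P" "x \<noteq> 0" "\<And>z v. z \<in> partners x \<Longrightarrow> v \<in> U \<Longrightarrow> v x z = 0"
    using exists_vector_orthogonal_to_partners dimP by auto
  obtain y' where y': "y' \<in> P" "s x y' \<noteq> 0" using nondegenerate_base x(1,2) by blast
  define y where "y = scale (1 / s x y') y'"
  have y: "y \<in> P" "s x y = 1"
    using y' subspace_scale[OF subspace_P] by (auto simp: y_def simps)
  define H where "H = {q\<in>P. s x q = 0}"
  have subH: "subspace H" unfolding H_def by (rule subspace_functional_kernel[OF subspace_P linear_right])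
  have dimH: "dim H = Suc d"
    using dim_kernel[OF subspace_P linear_right, of y x] y dimP by (simp add: H_def)
  have xH: "x \<in> H" and HP: "H \<subseteq> P" using x by (auto simp: H_def)
  let ?Z = "partners x"
  have ZH: "?Z \<subseteq> H" by (auto simp: partners_def H_def)

  obtain BZ where BZ: "BZ \<subseteq> ?Z" "independent BZ" "?Z \<subseteq> span BZ" "card BZ = dim ?Z"
    by (rule basis_exists)
  obtain BY where BY: "BZ \<subseteq> BY" "BY \<subseteq> H" "independent BY" "H \<subseteq> span BY"
    by (rule maximal_independent_subset_extend[of BZ H]) (use BZ ZH in auto)
  \<comment> \<open>On the partners \<open>u x\<close> vanishes by the choice of \<open>x\<close>,
    so only the remaining basis vectors of \<open>H\<close> impose conditions.\<close>
  define Y where "Y = BY - BZ"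
  have finY: "finite BY" using BY finiteI_independent by blast
  have cardY: "card Y + dim ?Z = Suc d"
    using BY BZ(4) finY dimH basis_card_eq_dim[OF BY(2,4,3)] card_mono[OF finY BY(1)]
    by (simp add: Y_def card_Diff_subset finite_subset)

  obtain C where C: "finite C" "C \<subseteq> H" "card C + dim {z\<in>?Z. \<forall>h\<in>H. s z h = 0} \<le> dim ?Z"
    "{z\<in>?Z. \<forall>h\<in>C. s z h = 0} = {z\<in>?Z. \<forall>h\<in>H. s z h = 0}"
    using finite_test_functionals[OF partners_subspace, of H "\<lambda>h z. s z h" x] linear_left by blast
  \<comment> \<open>The common kernel contains \<open>x\<close>, so at least one dimension of
    \<open>partners x\<close> is not cut away and \<open>C\<close> has at most
    \<open>dim (partners x) - 1\<close> elements.\<close>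
  have "{x} \<subseteq> {z\<in>?Z. \<forall>h\<in>H. s z h = 0}" using self_partner[OF x(1)] by (auto simp: H_def)
  then have "dim {x} \<le> dim {z\<in>?Z. \<forall>h\<in>H. s z h = 0}" by (rule dim_subset)
  then have cardC: "card C + 1 \<le> dim ?Z" using C(3) x(2) by simp

  \<comment> \<open>A pair stands for the condition that \<open>u\<close> vanishes at it: pairs over
    \<open>x\<close> will give \<open>u x = 0\<close>, pairs over \<open>y\<close> will exclude rank
    two forms that vanish on \<open>H\<close>.\<close>
  define I where "I = {x} \<times> Y \<union> {y} \<times> C"
  have finI: "finite I" using finY C(1) by (auto simp: I_def Y_def)
  have "card I \<le> card Y + card C"
    unfolding I_def by (rule order_trans[OF card_Un_le]) (simp add: card_cartesian_product)
  then have cardI: "card I \<le> d" using cardY cardC by linarith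
  define U' where "U' = {u\<in>U. \<forall>i\<in>I. u (fst i) (snd i) = 0}"
  have U'U: "U' \<subseteq> U" by (auto simp: U'_def)
  have subU': "form.subspace U'"
    using subspace_U by (intro form_subspaceI)
      (auto simp: U'_def form.subspace_0 form.subspace_add form.subspace_scale)

  have ux: "u x q = 0" if u: "u \<in> U'" and q: "q \<in> P" for u q
  proof -
    have uU: "u \<in> U" using u U'U by blast
    interpret u: alternating_form scale u by (rule U_form[OF uU])
    have "u x b = 0" if b: "b \<in> BY" for b
    proof (cases "b \<in> BZ")
      case True
      then show ?thesis using BZ(1) x(3)[OF _ uU] by blast
    next
      case False
      then have "(x, b) \<in> I" using b by (simp add: I_def Y_def)
      then show ?thesis using u by (force simp: U'_def)
    qed
    then have "u x h = 0" if "h \<in> H" for h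
      using functional_eq_zero_on_span[OF u.linear_right] BY(4) that by blast
    then obtain c where c: "\<And>q. q \<in> P \<Longrightarrow> u x q = c * s x q"
      using functional_multiple[OF subspace_P linear_right u.linear_right, of x x]
      by (auto simp: H_def)
    \<comment> \<open>Otherwise \<open>x\<close> would be in the radical of
      \<open>s - u / c\<close>.\<close>
    have "c = 0"
    proof (rule ccontr)
      assume "c \<noteq> 0"
      then have "x = 0"
        by (intro nondegenerate_combination[OF uU uU x(1), of "- 1 / c" 0]) (simp add: c)
      with x(2) show False by simp
    qed
    with c[OF q] show ?thesis by simp
  qed

  have u0: "u = 0" if u: "u \<in> U'" and uH: "\<And>p q. p \<in> H \<Longrightarrow> q \<in> H \<Longrightarrow> u p q = 0" for u
  proof -
    have uU: "u \<in> U" using u U'U by blast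
    interpret u: alternating_form scale u by (rule U_form[OF uU])
    \<comment> \<open>A form vanishing on \<open>H\<close> is determined by \<open>u y\<close>; with
      \<open>z\<close> representing \<open>u y\<close> it is the rank two form of \<open>x\<close>
      and \<open>z\<close>. Thus \<open>z\<close> is a partner, and the conditions from
      \<open>C\<close> force it into the line of \<open>x\<close>.\<close>
    obtain z where z: "z \<in> P" "\<And>q. q \<in> P \<Longrightarrow> s z q = u y q"
      using representable[OF u.linear_right] by blast
    have szx: "s z x = 0" using z(2)[OF x(1)] u.skew[of y x] ux[OF u y(1)] by simp
    have upq: "u p q = s x p * s z q - s x q * s z p" if p: "p \<in> P" and q: "q \<in> P" for p q
    proof -
      have "p - scale (s x p) y \<in> H" "q - scale (s x q) y \<in> H"
        using p q y subspace_P by (auto simp: H_def simps subspace_diff subspace_scale)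
      from uH[OF this] have "u p q = s x p * u y q + s x q * u p y"
        by (simp add: u.simps algebra_simps)
      then show ?thesis using u.skew[of p y] z(2) p q by simp
    qed
    have "z \<in> ?Z"
      using z(1) szx skew[of x z] uU upq by (intro partnersI[of _ _ u]) auto
    moreover have "s z h = 0" if "h \<in> C" for h
    proof -
      have "(y, h) \<in> I" using that by (simp add: I_def)
      then have "u y h = 0" using u by (force simp: U'_def)
      then show ?thesis using z(2)[of h] C(2) HP that by auto
    qed
    ultimately have "\<forall>h\<in>H. s z h = 0" using C(4) by blast
    then have "z \<in> span {x}"
      using orthogonal_complement_line[OF x(1) z(1)] by (auto simp: H_def)
    then obtain c where "z = scale c x" by (auto simp: span_singleton)
    then show "u = 0" using upq by (intro inj[OF uU]) (simp add: simps)
  qed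

  obtain BX where BX: "{x} \<subseteq> BX" "BX \<subseteq> H" "independent BX" "H \<subseteq> span BX"
    by (rule maximal_independent_subset_extend[of "{x}" H]) (use x xH in auto)
  \<comment> \<open>A complement of \<open>x\<close> in its orthogonal \<open>H\<close>, as a
    concrete stand-in for the quotient of \<open>H\<close> by that line.\<close>
  define P' where "P' = span (BX - {x})"
  have P'H: "P' \<subseteq> H" unfolding P'_def using BX(2) by (intro span_minimal[OF _ subH]) auto
  have xP': "x \<notin> P'" using BX(1,3) by (auto simp: P'_def dependent_def)
  have subP': "subspace P'" by (simp add: P'_def)
  have "dim P' = card (BX - {x})"
    unfolding P'_def using BX(3) independent_mono by (intro dim_span_eq_card_independent) auto
  also have "\<dots> = d"
    using BX(1) basis_card_eq_dim[OF BX(2,4,3)] finiteI_independent[OF BX(3)] dimH by simp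
  finally have dimP': "dim P' = d" .
  have split: "\<exists>k. h - scale k x \<in> P'" if "h \<in> H" for h
    using BX(1,4) that span_breakdown_eq[of h x "BX - {x}"] by (auto simp: P'_def insert_absorb)

  have nondeg: "w = 0" if u: "u \<in> U'" and w: "w \<in> P'" and sw: "\<And>q. q \<in> P' \<Longrightarrow> s w q + u w q = 0"
    for u w
  proof -
    have uU: "u \<in> U" using u U'U by blast
    interpret u: alternating_form scale u by (rule U_form[OF uU])
    have wP: "w \<in> P" and sxw: "s x w = 0" using w P'H by (auto simp: H_def)
    have "s w x + u w x = 0" using sxw skew[of w x] u.skew[of w x] ux[OF u wP] by simp
    then have wH: "s w q + u w q = 0" if qH: "q \<in> H" for q
    proof -
      obtain k where "q - scale k x \<in> P'" using split[OF qH] by blast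
      from sw[OF this] have "s w q + u w q = k * (s w x + u w x)"
        by (simp add: simps u.simps algebra_simps)
      with \<open>s w x + u w x = 0\<close> show ?thesis by simp
    qed
    \<comment> \<open>Since \<open>s w + u w\<close> vanishes on \<open>H\<close>, it equals
      \<open>k\<close> times \<open>s x\<close> on \<open>P\<close>. As \<open>u x\<close> vanishes,
      \<open>w - scale k x\<close> is in the radical of \<open>s + u\<close>.\<close>
    define k where "k = s w y + u w y"
    have "w - scale k x = 0"
    proof (rule nondegenerate[OF uU])
      show "w - scale k x \<in> P" using wP x(1) subspace_P by (simp add: subspace_diff subspace_scale)
      fix q assume q: "q \<in> P"
      have "q - scale (s x q) y \<in> H"
        using q y subspace_P by (auto simp: H_def simps subspace_diff subspace_scale)
      from wH[OF this] have "s w q + u w q = s x q * k"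
        by (simp add: simps u.simps k_def algebra_simps)
      then show "s (w - scale k x) q + u (w - scale k x) q = 0"
        using ux[OF u q] by (simp add: simps u.simps algebra_simps)
    qed
    then have w_eq: "w = scale k x" by simp
    have "k = 0"
    proof (rule ccontr)
      assume "k \<noteq> 0"
      then have "x = scale (1 / k) w" by (simp add: w_eq)
      then show False using xP' subspace_scale[OF subP' w] by metis
    qed
    then show "w = 0" by (simp add: w_eq)
  qed

  show thesis
  proof (rule that[of P' U'])
    show "symplectic_pencil scale Basis s P' U'"
    proof (unfold_locales)
      show "subspace P'" "form.subspace U'" "U' \<subseteq> alternating_forms scale"
        using subP' subU' U'U U_alternating by auto
      show "w = 0" if "u \<in> U'" "w \<in> P'" "\<And>q. q \<in> P' \<Longrightarrow> s w q + u w q = 0" for u w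
        using nondeg that by blast
    qed
    show "dim P' = d" by (rule dimP')
  next
    fix u assume u: "u \<in> U'" and z: "\<And>p q. p \<in> P' \<Longrightarrow> q \<in> P' \<Longrightarrow> u p q = 0"
    have uU: "u \<in> U" using u U'U by blast
    interpret u: alternating_form scale u by (rule U_form[OF uU])
    \<comment> \<open>Because \<open>u x\<close> vanishes on \<open>P\<close>, adding multiples of
      \<open>x\<close> extends the vanishing from \<open>P'\<close> to \<open>H\<close>.\<close>
    show "u = 0"
    proof (rule u0[OF u])
      fix p q assume pq: "p \<in> H" "q \<in> H"
      then obtain k l where kl: "p - scale k x \<in> P'" "q - scale l x \<in> P'" using split by metis
      have "u x p = 0" "u x q = 0" using ux[OF u] HP pq by auto
      with z[OF kl] show "u p q = 0" using u.skew[of p x] by (simp add: u.simps)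
    qed
  next
    fix B :: "('v \<Rightarrow> 'v \<Rightarrow> 'f) set" and k
    assume B: "finite B" "card B \<le> k" "U' \<subseteq> form.span B"
    obtain B' where "finite B'" "card B' \<le> k + card I" "U \<subseteq> form.span B'"
      by (rule form.span_common_kernel[OF finI subspace_U, of "\<lambda>i u. u (fst i) (snd i)" B k])
        (use B linear_evaluation U'_def in auto)
    then show "\<exists>B'. finite B' \<and> card B' \<le> k + d \<and> U \<subseteq> form.span B'"
      using cardI by (intro exI[of _ B']) auto
  qed
qed

end

text \<open>Induction by \<open>reduction\<close>. Forms in \<open>U\<close> live on the whole
  space, so their being determined on \<open>P\<close> is a separate assumption, which
  \<open>reduction\<close> passes on.\<close>

theorem symplectic_pencil_span_bound:
  assumes "symplectic_pencil scale Basis s P U" "vector_space.dim scale P = 2 * n"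
    and "\<And>u. u \<in> U \<Longrightarrow> (\<And>p q. p \<in> P \<Longrightarrow> q \<in> P \<Longrightarrow> u p q = 0) \<Longrightarrow> u = 0"
  shows "\<exists>B. finite B \<and> card B \<le> n * (n - 1) \<and> U \<subseteq> form.span B"
  using assms
proof (induction n arbitrary: P U)
  case 0
  then interpret symplectic_pencil scale Basis s P U by simp
  have "P \<subseteq> {0}" using "0.prems"(2) by simp
  have "u = 0" if "u \<in> U" for u
  proof (rule "0.prems"(3)[OF that])
    interpret u: alternating_form scale u by (rule U_form[OF that])
    fix p q assume "p \<in> P" "q \<in> P"
    then show "u p q = 0" using \<open>P \<subseteq> {0}\<close> by auto
  qed
  then have "U \<subseteq> form.span {}" unfolding form.span_empty by blast
  then show ?case by (intro exI[of _ "{}"] conjI) (assumption | simp)+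
next
  case (Suc n)
  then interpret symplectic_pencil scale Basis s P U by simp
  have dim: "dim P = Suc (Suc (2 * n))" using Suc.prems(2) by simp
  show ?case
  proof (rule reduction[OF Suc.prems(3) dim])
    fix P' U'
    assume P': "symplectic_pencil scale Basis s P' U'" "dim P' = 2 * n"
      "\<And>u. u \<in> U' \<Longrightarrow> (\<And>p q. p \<in> P' \<Longrightarrow> q \<in> P' \<Longrightarrow> u p q = 0) \<Longrightarrow> u = 0"
      and step: "\<And>B k. finite B \<Longrightarrow> card B \<le> k \<Longrightarrow> U' \<subseteq> form.span B \<Longrightarrow>
        \<exists>B'. finite B' \<and> card B' \<le> k + 2 * n \<and> U \<subseteq> form.span B'"
    obtain B where B: "finite B" "card B \<le> n * (n - 1)" "U' \<subseteq> form.span B"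
      using Suc.IH[OF P'] by blast
    \<comment> \<open>The reduction costs \<open>d = 2 * n\<close> conditions; the case split takes
      care of truncated subtraction at \<open>n = 0\<close>.\<close>
    have eq: "n * (n - 1) + 2 * n = Suc n * (Suc n - 1)" by (cases n) auto
    show "\<exists>B. finite B \<and> card B \<le> Suc n * (Suc n - 1) \<and> U \<subseteq> form.span B"
      using step[OF B] unfolding eq .
  qed
qed

section \<open>Forms attached to a quadratic operator\<close>

lemma (in vector_space) independent_biorthogonal:
  assumes "\<And>i. i \<in> I \<Longrightarrow> Vector_Spaces.linear scale (*) (\<phi> i)"
    and "\<And>i j. i \<in> I \<Longrightarrow> j \<in> I \<Longrightarrow> \<phi> i (w j) = (if i = j then 1 else 0)"
  shows "independent (w ` I)" "inj_on w I"
proof -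
  show inj: "inj_on w I"
    using assms(2) by (metis inj_onI zero_neq_one)
  show "independent (w ` I)"
    unfolding dependent_def
  proof safe
    fix i assume i: "i \<in> I" and span: "w i \<in> span (w ` I - {w i})"
    have "\<phi> i (w i) = 0"
      by (rule functional_eq_zero_on_span[OF assms(1)[OF i] _ span]) (use assms(2) i in auto)
    then show False using assms(2)[OF i i] by simp
  qed
qed

definition wedge :: "('v \<Rightarrow> 'f::field) \<Rightarrow> ('v \<Rightarrow> 'f) \<Rightarrow> 'v \<Rightarrow> 'v \<Rightarrow> 'f" where
  "wedge f g = (\<lambda>p q. f p * g q - f q * g p)"

text \<open>\<tau> and \<delta> play the roles of trace and norm of \<open>a\<close>. Irreducibility
  of t^2 - \<tau> t + \<delta> enters through nonisotropy, which excludes eigenvectors.\<close>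

locale nonisotropic_operator =
  finite_dimensional_vector_space scale Basis + alternating_form scale s
  for scale :: "'f::field \<Rightarrow> 'v::ab_group_add \<Rightarrow> 'v" and Basis s +
  fixes a :: "'v \<Rightarrow> 'v" and \<tau> \<delta> :: 'f
  assumes a_add: "a (x + y) = a x + a y" and a_scale: "a (scale c x) = scale c (a x)"
    and a_square: "a (a x) = scale \<tau> (a x) - scale \<delta> x"
    and nonisotropic: "x \<noteq> 0 \<Longrightarrow> s x (a x) \<noteq> 0"
begin

lemma a_zero [simp]: "a 0 = 0"
  using a_scale[of 0 0] by simp

lemma a_diff: "a (x - y) = a x - a y"
  using a_add[of "x - y" y] by simp

lemma no_eigenvector: "a x = scale k x \<Longrightarrow> x = 0"
  using nonisotropic[of x] by (auto simp: scale_right)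

text \<open>Linear independence of \<open>E\<close> over the algebra generated by \<open>a\<close>,
  expressed over the base field.\<close>

definition adapted :: "'v set \<Rightarrow> bool" where
  "adapted E \<longleftrightarrow> finite E \<and> inj_on a E \<and> E \<inter> a ` E = {} \<and> independent (E \<union> a ` E)"

lemma a_span: "x \<in> span (E \<union> a ` E) \<Longrightarrow> a x \<in> span (E \<union> a ` E)"
proof (induction rule: span_induct_alt)
  case base
  then show ?case by (simp add: span_zero)
next
  case (step c x y)
  have "a x \<in> span (E \<union> a ` E)"
    using step.hyps by (auto simp: a_square span_base span_diff span_scale)
  then show ?case using step.IH by (simp add: a_add a_scale span_add span_scale)
qed

lemma adapted_insert:
  assumes E: "adapted E" and x: "x \<notin> span (E \<union> a ` E)"
  shows "adapted (insert x E)"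
proof -
  let ?M = "span (E \<union> a ` E)"
  have ax: "a x \<notin> span (insert x (E \<union> a ` E))"
  proof
    assume "a x \<in> span (insert x (E \<union> a ` E))"
    then obtain k where k: "a x - scale k x \<in> ?M" using span_breakdown_eq by blast
    \<comment> \<open>The value at \<open>k\<close> of t^2 - \<tau> t + \<delta>. Applying
      \<open>a - (\<tau> - k)\<close> to \<open>a x - scale k x\<close> gives \<open>- c\<close>
      times \<open>x\<close>, so \<open>c\<close> must vanish; but then the polynomial splits and
      \<open>a\<close> has an eigenvector.\<close>
    define c where "c = k * k - \<tau> * k + \<delta>"
    have "a (a x - scale k x) - scale (\<tau> - k) (a x - scale k x) \<in> ?M"
      by (rule span_diff[OF a_span[OF k] span_scale[OF k]])
    also have "a (a x - scale k x) - scale (\<tau> - k) (a x - scale k x) = scale (- c) x"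
      by (simp add: a_diff a_scale a_square c_def algebra_simps)
    finally have "scale (- 1 / c) (scale (- c) x) \<in> ?M" by (rule span_scale)
    with x have "c = 0" by (cases "c = 0") auto
    then have \<delta>: "\<delta> = k * (\<tau> - k)" by (simp add: c_def algebra_simps)
    have "a (a x - scale (\<tau> - k) x) = scale k (a x - scale (\<tau> - k) x)"
      by (simp add: a_diff a_add a_scale a_square \<delta> algebra_simps)
    then have "a x - scale (\<tau> - k) x = 0" by (rule no_eigenvector)
    then have "x = 0" by (intro no_eigenvector[of x "\<tau> - k"]) simp
    with x show False by (simp add: span_zero)
  qed
  have notin: "x \<notin> E" "x \<notin> a ` E" "a x \<noteq> x" "a x \<notin> E" "a x \<notin> a ` E"
    using x ax span_base by auto
  have "independent (insert (a x) (insert x (E \<union> a ` E)))"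
    using E x ax by (simp add: adapted_def independent_insertI)
  then have "independent (insert x E \<union> a ` insert x E)" by (simp add: insert_commute)
  with E notin show ?thesis by (auto simp: adapted_def)
qed

lemma adapted_card: "adapted E \<Longrightarrow> card (E \<union> a ` E) = 2 * card E"
  by (simp add: adapted_def card_Un_disjoint card_image)

lemma adapted_exists:
  assumes "2 * k \<le> dim UNIV"
  shows "\<exists>E. adapted E \<and> card E = k"
  using assms
proof (induction k)
  case 0
  then show ?case by (intro exI[of _ "{}"]) (simp add: adapted_def independent_empty)
next
  case (Suc k)
  then obtain E where E: "adapted E" "card E = k" by auto
  have "dim (E \<union> a ` E) \<le> 2 * k"
    using dim_le_card[OF span_superset, of "E \<union> a ` E"] E adapted_card by (simp add: adapted_def)
  then have "dim (span (E \<union> a ` E)) \<noteq> dim UNIV" using Suc.prems by simp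
  then obtain x where x: "x \<notin> span (E \<union> a ` E)" by (metis UNIV_eq_I)
  then have "x \<notin> E" using span_base by blast
  then show ?case using adapted_insert[OF E(1) x] E
    by (intro exI[of _ "insert x E"]) (simp add: adapted_def)
qed

text \<open>The values are those of the \<open>a\<close>-coordinate of the functional with values in
  \<open>F[a]\<close> that is 1 at \<open>e\<close> and 0 at the other elements of
  \<open>E\<close>.\<close>

lemma dual_functional:
  assumes E: "adapted E" and e: "e \<in> E"
  obtains f where "Vector_Spaces.linear scale (*) f" "\<And>e'. e' \<in> E \<Longrightarrow> f e' = 0"
    "\<And>e'. e' \<in> E \<Longrightarrow> f (a e') = (if e' = e then 1 else 0)"
proof -
  interpret pair: vector_space_pair scale "(*) :: 'f \<Rightarrow> 'f \<Rightarrow> 'f"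
    by (simp add: vector_space_pair_def vector_space_axioms vector_space_mult)
  obtain f where f: "Vector_Spaces.linear scale (*) f"
    "\<And>x. x \<in> E \<union> a ` E \<Longrightarrow> f x = (if x = a e then 1 else 0)"
    using pair.linear_independent_extend[of "E \<union> a ` E" "\<lambda>x. if x = a e then 1 else 0"] E
    by (auto simp: adapted_def)
  show thesis
  proof (rule that[OF f(1)])
    show "f e' = 0" if "e' \<in> E" for e' using f(2)[of e'] that e E by (auto simp: adapted_def)
    show "f (a e') = (if e' = e then 1 else 0)" if "e' \<in> E" for e'
      using f(2)[of "a e'"] that e E by (auto simp: adapted_def inj_on_def)
  qed
qed

text \<open>
  If \<open>a\<close> generates a field, a functional \<open>f\<close> is the \<open>a\<close>-coordinate of the linear map
  \<open>F x = unit_part f x + f x \<cdot> a\<close> with values in that field, and the next two forms are the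
  coordinates of \<open>F x * G y - F y * G x\<close>.
\<close>
definition unit_part :: "('v \<Rightarrow> 'f) \<Rightarrow> 'v \<Rightarrow> 'f" where
  "unit_part f x = f (a x) - \<tau> * f x"

definition re_form :: "('v \<Rightarrow> 'f) \<Rightarrow> ('v \<Rightarrow> 'f) \<Rightarrow> 'v \<Rightarrow> 'v \<Rightarrow> 'f" where
  "re_form f g = (\<lambda>x y. wedge (unit_part f) (unit_part g) x y - \<delta> * wedge f g x y)"

definition im_form :: "('v \<Rightarrow> 'f) \<Rightarrow> ('v \<Rightarrow> 'f) \<Rightarrow> 'v \<Rightarrow> 'v \<Rightarrow> 'f" where
  "im_form f g = (\<lambda>x y. wedge (unit_part f) g x y + wedge f (unit_part g) x y + \<tau> * wedge f g x y)"

lemma unit_part_a: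
  assumes "Vector_Spaces.linear scale (*) f"
  shows "unit_part f (a x) = - \<delta> * f x"
  using assms functional_diff[OF assms] by (simp add: unit_part_def a_square linear_functional_iff)

lemma unit_part_linear:
  assumes "Vector_Spaces.linear scale (*) f"
  shows "Vector_Spaces.linear scale (*) (unit_part f)"
  using assms by (simp add: unit_part_def a_add a_scale linear_functional_iff algebra_simps)

lemma W_spaceI:
  assumes L: "\<And>l. l \<in> L \<Longrightarrow> \<exists>c d. \<forall>x. l x = scale c x + scale d (a x)"
    and w: "bilinear_form scale w" "\<And>x. w x x = 0" "\<And>x. w x (a x) = 0"
  shows "w \<in> W_space scale L"
  unfolding W_space_def
proof safe
  fix x l assume "l \<in> L"
  then obtain c d where "\<And>x. l x = scale c x + scale d (a x)" using L by blast
  then show "w x (l x) = 0" using w by (simp add: bilinear_form_iff)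
qed (rule w(1))

text \<open>With F and G as above, F(a x) = a F(x) and likewise for G, so F(x) G(a x) - F(a x) G(x)
  = 0 in both coordinates.\<close>

lemma re_im_form_W_space:
  assumes L: "\<And>l. l \<in> L \<Longrightarrow> \<exists>c d. \<forall>x. l x = scale c x + scale d (a x)"
    and f: "Vector_Spaces.linear scale (*) f" and g: "Vector_Spaces.linear scale (*) g"
  shows "re_form f g \<in> W_space scale L" "im_form f g \<in> W_space scale L"
proof -
  note lin = f g unit_part_linear[OF f] unit_part_linear[OF g]
  show "re_form f g \<in> W_space scale L"
  proof (rule W_spaceI[OF L])
    show "bilinear_form scale (re_form f g)"
      using lin by (simp add: re_form_def wedge_def bilinear_form_iff linear_functional_iff algebra_simps)
    show "re_form f g x (a x) = 0" for x
      unfolding re_form_def wedge_def unit_part_a[OF f] unit_part_a[OF g]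
      by (simp add: unit_part_def algebra_simps)
  qed (simp_all add: re_form_def wedge_def)
  show "im_form f g \<in> W_space scale L"
  proof (rule W_spaceI[OF L])
    show "bilinear_form scale (im_form f g)"
      using lin by (simp add: im_form_def wedge_def bilinear_form_iff linear_functional_iff algebra_simps)
    show "im_form f g x (a x) = 0" for x
      unfolding im_form_def wedge_def unit_part_a[OF f] unit_part_a[OF g]
      by (simp add: unit_part_def algebra_simps)
  qed (simp_all add: im_form_def wedge_def)
qed

lemma W_space_separates:
  assumes L: "\<And>l. l \<in> L \<Longrightarrow> \<exists>c d. \<forall>x. l x = scale c x + scale d (a x)"
    and x: "x \<noteq> 0" and y: "y \<notin> span {x, a x}"
  obtains w where "w \<in> W_space scale L" "w x y \<noteq> 0"
proof -
  have "adapted {}" by (simp add: adapted_def independent_empty)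
  then have "adapted {x}" using adapted_insert[of "{}" x] x by simp
  then have E: "adapted {y, x}" using adapted_insert[of "{x}" y] y by (simp add: insert_commute)
  have "x \<noteq> y" using y span_base by auto
  obtain f where f: "Vector_Spaces.linear scale (*) f" "\<And>e. e \<in> {y, x} \<Longrightarrow> f e = 0"
    "\<And>e. e \<in> {y, x} \<Longrightarrow> f (a e) = (if e = x then 1 else 0)"
    by (rule dual_functional[OF E, of x]) auto
  obtain g where g: "Vector_Spaces.linear scale (*) g" "\<And>e. e \<in> {y, x} \<Longrightarrow> g e = 0"
    "\<And>e. e \<in> {y, x} \<Longrightarrow> g (a e) = (if e = y then 1 else 0)"
    by (rule dual_functional[OF E, of y]) auto
  have "re_form f g x y = 1"
    using f(2,3)[of x] f(2,3)[of y] g(2,3)[of x] g(2,3)[of y] \<open>x \<noteq> y\<close>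
    by (simp add: re_form_def wedge_def unit_part_def)
  then show thesis using that[of "re_form f g"] re_im_form_W_space(1)[OF L f(1) g(1)] by simp
qed

lemma W_space_independent_subset:
  assumes L: "\<And>l. l \<in> L \<Longrightarrow> \<exists>c d. \<forall>x. l x = scale c x + scale d (a x)"
    and n: "2 * n \<le> dim UNIV"
  obtains A where "A \<subseteq> W_space scale L" "form.independent A" "card A = n * (n - 1)"
proof -
  obtain E where E: "adapted E" "card E = n" using adapted_exists[OF n] by blast
  then obtain e where e: "bij_betw e {0..<n} E"
    using ex_bij_betw_nat_finite[of E] by (auto simp: adapted_def)
  have "\<exists>f. Vector_Spaces.linear scale (*) f \<and> (\<forall>e'\<in>E. f e' = 0) \<and>
      (\<forall>e'\<in>E. f (a e') = (if e' = e i then 1 else 0))" if "i < n" for i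
    using dual_functional[OF E(1), of "e i"] e that bij_betwE[OF e] by (metis atLeast0LessThan lessThan_iff)
  then obtain f where f: "\<And>i. i < n \<Longrightarrow> Vector_Spaces.linear scale (*) (f i)"
    "\<And>i e'. i < n \<Longrightarrow> e' \<in> E \<Longrightarrow> f i e' = 0"
    "\<And>i e'. i < n \<Longrightarrow> e' \<in> E \<Longrightarrow> f i (a e') = (if e' = e i then 1 else 0)"
    by metis
  have eE: "e i \<in> E" if "i < n" for i using that bij_betwE[OF e] by auto
  have e_inj: "e i = e j \<longleftrightarrow> i = j" if "i < n" "j < n" for i j
    using that e by (auto simp: bij_betw_def inj_on_def)
  have fe: "f i (e j) = 0" "f i (a (e j)) = (if i = j then 1 else 0)"
    "unit_part (f i) (e j) = (if i = j then 1 else 0)" "unit_part (f i) (a (e j)) = 0"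
    if "i < n" "j < n" for i j
    using f(1)[OF that(1)] f(2,3)[OF that(1) eE[OF that(2)]] e_inj[OF that]
    by (auto simp: unit_part_a) (auto simp: unit_part_def)
  \<comment> \<open>An ordered pair of distinct indices encodes an unordered pair together with a
    choice of coordinate, which accounts for \<open>n * (n - 1)\<close> forms.\<close>
  define I where "I = (SIGMA i:{..<n}. {..<n} - {i})"
  define w where "w = (\<lambda>(i, j). if i < j then re_form (f i) (f j) else im_form (f j) (f i))"
  \<comment> \<open>The \<open>F[a]\<close>-valued form of indices i and j is 1 at
    \<open>(e i, e j)\<close> and \<open>a\<close> at \<open>(e i, a (e j))\<close>, so these
    evaluations detect exactly the first and the second coordinate.\<close>
  define \<phi> where "\<phi> = (\<lambda>(k, l) u. if k < l then u (e k) (e l) else (u (e l) (a (e k)) :: 'f))"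
  have lin: "Vector_Spaces.linear form_scale (*) (\<phi> p)" for p
    by (cases "fst p < snd p") (simp_all add: \<phi>_def linear_evaluation case_prod_unfold)
  have dual: "\<phi> p (w q) = (if p = q then 1 else 0)" if "p \<in> I" "q \<in> I" for p q
    using that
    by (auto simp: I_def \<phi>_def w_def re_form_def im_form_def wedge_def fe split: if_splits)
  note ind = form.independent_biorthogonal[of I \<phi> w, OF lin dual]
  have "card I = n * (n - 1)" by (simp add: I_def card_SigmaI)
  then have "card (w ` I) = n * (n - 1)" using ind(2) by (simp add: card_image)
  moreover have "re_form (f i) (f j) \<in> W_space scale L" "im_form (f i) (f j) \<in> W_space scale L"
    if "i < n" "j < n" for i j
    using re_im_form_W_space[of L "f i" "f j"] L f(1) that by blast+
  then have "w ` I \<subseteq> W_space scale L" by (auto simp: I_def w_def split: if_splits)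
  ultimately show thesis using that ind(1) by blast
qed

end

section \<open>Affine subspaces of alternating forms and their dimension\<close>

lemma (in vector_space) W_space_subspace: "form.subspace (W_space scale L)"
  by (intro form_subspaceI) (auto simp: W_space_def bilinear_form_iff algebra_simps)

lemma affine_dimension_translate:
  assumes "form.subspace U"
  shows "affine_dimension form_scale ((+) p ` U) = form.dim U"
proof -
  have "{x - y | x y. x \<in> (+) p ` U \<and> y \<in> (+) p ` U} = U"
  proof safe
    fix u v assume "u \<in> U" "v \<in> U"
    then show "p + u - (p + v) \<in> U" using form.subspace_diff[OF assms] by simp
  next
    fix u assume "u \<in> U"
    then show "\<exists>x y. u = x - y \<and> x \<in> (+) p ` U \<and> y \<in> (+) p ` U"
      using form.subspace_0[OF assms] by (intro exI[of _ "p + u"] exI[of _ "p + 0"]) auto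
  qed
  then show ?thesis by (simp add: affine_dimension_def)
qed

text \<open>Skew symmetry exchanges the right radical of the definition with the left radical tested
  in a pencil.\<close>

lemma (in vector_space) nondegenerate_iff:
  assumes "t \<in> alternating_forms scale"
  shows "nondegenerate t \<longleftrightarrow> (\<forall>w. (\<forall>q. t w q = 0) \<longrightarrow> w = 0)"
proof -
  interpret t: alternating_form scale t by (rule alternating_formI[OF assms])
  have "t x y = 0 \<longleftrightarrow> t y x = 0" for x y using t.skew[of x y] by auto
  then show ?thesis by (auto simp: nondegenerate_def orthogonal_of_def)
qed

context finite_dimensional_vector_space begin

text \<open>A base point \<open>p\<close> and the direction space \<open>U\<close> form a pencil on
  the whole space, where a form is trivially determined by its values.\<close>

lemma symplectic_affine_subspace_bound:
  assumes Y: "symplectic_affine_subspace scale Y" and n: "dim UNIV = 2 * n"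
  obtains p U B where "form.subspace U" "Y = (+) p ` U" "finite B" "card B \<le> n * (n - 1)" "U \<subseteq> form.span B"
proof -
  obtain p U where U: "form.subspace U" "Y = (+) p ` U"
    using Y by (auto simp: symplectic_affine_subspace_def affine_subspace_def)
  have alt: "p + u \<in> alternating_forms scale" "nondegenerate (p + u)" if "u \<in> U" for u
    using Y U(2) that by (auto simp: symplectic_affine_subspace_def)
  have p: "p \<in> alternating_forms scale" using alt(1)[of 0] form.subspace_0[OF U(1)] by simp
  have Ualt: "U \<subseteq> alternating_forms scale"
    using form.subspace_diff[OF alternating_forms_subspace alt(1) p] by auto
  interpret p: alternating_form scale p by (rule alternating_formI[OF p])
  have pencil: "symplectic_pencil scale Basis p UNIV U"
  proof unfold_locales
    show "w = 0" if "u \<in> U" "w \<in> UNIV" "\<And>q. q \<in> UNIV \<Longrightarrow> p w q + u w q = 0" for u w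
      using alt[OF that(1)] nondegenerate_iff[of "p + u"] that(3) by auto
  qed (use U(1) Ualt in auto)
  have "\<exists>B. finite B \<and> card B \<le> n * (n - 1) \<and> U \<subseteq> form.span B"
    by (rule symplectic_pencil_span_bound[OF pencil n]) (simp add: fun_eq_iff)
  with U that show thesis by blast
qed

end

lemma (in vector_space) two_dimensional_generators:
  assumes L: "subspace L" "dim L = 2" and e: "e \<in> L" "e \<noteq> 0" and a: "a \<in> L" "a \<notin> span {e}" and l: "l \<in> L"
  shows "l \<in> span {a, e}"
proof (rule ccontr)
  assume l': "l \<notin> span {a, e}"
  then have neq: "l \<noteq> a" "l \<noteq> e" "a \<noteq> e" using a(2) span_base by auto
  have "independent {l, a, e}" using e(2) a(2) l' by (simp add: independent_insertI)
  moreover obtain B where B: "B \<subseteq> L" "independent B" "L \<subseteq> span B" "card B = 2"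
    using basis_exists[of L] L(2) by metis
  \<comment> \<open>An infinite set has \<open>card\<close> 0, not 2.\<close>
  then have "finite B" using card.infinite by fastforce
  moreover have "{l, a, e} \<subseteq> span B" using B(3) l a(1) e(1) by auto
  ultimately have "card {l, a, e} \<le> 2" using independent_span_bound[of B] B(4) by metis
  with neq show False by simp
qed

section \<open>Irreducibility and optimality of the translate of \<open>W_space\<close>\<close>

theorem theorem1p9:
  fixes sc :: "'f::field \<Rightarrow> 'v::ab_group_add \<Rightarrow> 'v"
    and n :: nat
    and L :: "('v \<Rightarrow> 'v) set"
    and a :: "'v \<Rightarrow> 'v"
    and s0 :: "'v \<Rightarrow> 'v \<Rightarrow> 'f"
  assumes "vector_space sc"
    and "vector_space.dim sc (UNIV :: 'v set) = 2 * n"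
    and "n \<ge> 2"
    and "quadratic_extension sc L"
    and "a \<in> endomorphisms sc"
    and "L = generated_algebra sc a"
    and "s0 \<in> alternating_forms sc"
    and "nonisotropic (\<lambda>x y. s0 x (a y))"
  shows "irreducible_symplectic_set sc ((+) s0 ` W_space sc L)
       \<and> optimal_symplectic_affine_subspace sc ((+) s0 ` W_space sc L)
       \<and> affine_dimension form_scale ((+) s0 ` W_space sc L) = n * (n - 1)"
proof -
  interpret vector_space sc by fact
  obtain B where B: "independent B" "UNIV \<subseteq> span B" "card B = 2 * n"
    using basis_exists[of UNIV] assms(2) by metis
  interpret finite_dimensional_vector_space sc B
    using B assms(3) card.infinite[of B] by unfold_locales auto
  interpret s0: alternating_form sc s0 by (rule alternating_formI) fact
  interpret endo: vector_space "fun_scale sc :: 'f \<Rightarrow> ('v \<Rightarrow> 'v) \<Rightarrow> 'v \<Rightarrow> 'v"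
    by (rule vector_space_fun_scale) fact
  have a_lin: "a (x + y) = a x + a y" "a (sc c x) = sc c (a x)" for c x y
    using assms(5) by (auto simp: endomorphisms_def Vector_Spaces.linear_iff)
  have noniso: "s0 x (a x) \<noteq> 0" if "x \<noteq> 0" for x
    using assms(8) that by (simp add: nonisotropic_def)
  have "\<not> UNIV \<subseteq> {0 :: 'v}" using assms(2,3) dim_eq_0[of UNIV] by simp
  then obtain v :: 'v where v: "v \<noteq> 0" by blast

  have powers: "a ^^ k \<in> L" for k
    unfolding assms(6) generated_algebra_def by (rule endo.span_base) simp
  \<comment> \<open>A scalar \<open>a\<close> would give \<open>s0 v (a v) = 0\<close>, against
    nonisotropy.\<close>
  have "a \<notin> endo.span {id}"
  proof
    assume "a \<in> endo.span {id}"
    then obtain c where "a = fun_scale sc c id" by (auto simp: endo.span_singleton)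
    then have "a v = sc c v" by (simp add: fun_scale_def)
    then show False using noniso[OF v] by (simp add: s0.scale_right)
  qed
  moreover have "(id :: 'v \<Rightarrow> 'v) \<noteq> 0" using v by (auto simp: fun_eq_iff)
  ultimately have L_span: "l \<in> endo.span {a, id}" if "l \<in> L" for l
    using endo.two_dimensional_generators[of L id a l] assms(4) powers[of 0] powers[of 1] that
    by (simp add: quadratic_extension_def)
  have L_eq: "\<exists>c d. \<forall>x. l x = sc c x + sc d (a x)" if lL: "l \<in> L" for l
  proof -
    obtain d where "l - fun_scale sc d a \<in> endo.span {id}"
      using L_span[OF lL] endo.span_breakdown_eq by blast
    then obtain c where "l - fun_scale sc d a = fun_scale sc c id" by (auto simp: endo.span_singleton)
    then have "l x - sc d (a x) = sc c x" for x by (simp add: fun_eq_iff fun_scale_def)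
    then show ?thesis by (metis diff_add_cancel)
  qed
  obtain \<delta> \<tau> where square: "\<And>x. a (a x) = sc \<delta> x + sc \<tau> (a x)"
    using L_eq[OF powers[of 2]] by (auto simp: numeral_2_eq_2)
  interpret nonisotropic_operator sc B s0 a \<tau> "- \<delta>"
    by unfold_locales (use a_lin square noniso in \<open>auto simp: algebra_simps\<close>)

  let ?W = "W_space sc L"
  let ?X = "(+) s0 ` ?W"
  have idL: "id \<in> L" and aL: "a \<in> L" using powers[of 0] powers[of 1] by auto
  have "?W \<subseteq> alternating_forms sc"
    using idL by (force simp: W_space_def alternating_forms_def)
  then have alt: "?X \<subseteq> alternating_forms sc"
    using form.subspace_add[OF alternating_forms_subspace assms(7)] by auto
  have nondeg: "nondegenerate t" if t: "t \<in> ?X" for t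
  proof -
    obtain u where u: "u \<in> ?W" "t = s0 + u" using t by blast
    have "t w (a w) \<noteq> 0" if "w \<noteq> 0" for w
      using u aL noniso[OF that] by (auto simp: W_space_def)
    then show ?thesis using nondegenerate_iff[of t] alt t by blast
  qed
  have symp: "symplectic_affine_subspace sc ?X"
    unfolding symplectic_affine_subspace_def affine_subspace_def
    using alt nondeg W_space_subspace by blast

  have dim_le: "affine_dimension form_scale Y \<le> n * (n - 1)" if Y: "symplectic_affine_subspace sc Y" for Y
  proof -
    obtain p U B where *: "form.subspace U" "Y = (+) p ` U" "finite B" "card B \<le> n * (n - 1)"
      "U \<subseteq> form.span B"
      by (rule symplectic_affine_subspace_bound[OF Y assms(2)])
    then have "form.dim U \<le> card B" using form.dim_le_card by blast
    with * show ?thesis by (simp add: affine_dimension_translate)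
  qed
  have dim_X: "affine_dimension form_scale ?X = n * (n - 1)"
  proof (rule antisym)
    obtain A where A: "A \<subseteq> ?W" "form.independent A" "card A = n * (n - 1)"
      using W_space_independent_subset[OF L_eq, of L n] assms(2) by auto
    obtain p U B where *: "form.subspace U" "?X = (+) p ` U" "finite B" "U \<subseteq> form.span B"
      by (rule symplectic_affine_subspace_bound[OF symp assms(2)])
    \<comment> \<open>\<open>form.dim\<close> counts a basis and is 0 if that basis is infinite, so
      \<open>A\<close> alone gives no lower bound; \<open>A'\<close> is finite because
      \<open>?W\<close> lies in the span of the finite \<open>B\<close>.\<close>
    obtain A' where A': "A \<subseteq> A'" "A' \<subseteq> ?W" "form.independent A'" "?W \<subseteq> form.span A'"
      by (rule form.maximal_independent_subset_extend[OF A(1,2)])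
    have "u \<in> U" if "u \<in> ?W" for u
    proof -
      have "s0 + u \<in> (+) p ` U" "s0 + 0 \<in> (+) p ` U"
        using * that form.subspace_0[OF W_space_subspace] by auto
      then obtain u1 u2 where "s0 + u = p + u1" "s0 = p + u2" "u1 \<in> U" "u2 \<in> U" by auto
      then have "u = u1 - u2" by (simp add: algebra_simps)
      then show ?thesis using form.subspace_diff[OF *(1)] \<open>u1 \<in> U\<close> \<open>u2 \<in> U\<close> by simp
    qed
    then have "A' \<subseteq> form.span B" using A'(2) *(4) by blast
    then have "finite A'" using form.independent_span_bound[OF *(3) A'(3)] by blast
    then have "card A \<le> card A'" using A'(1) by (rule card_mono)
    also have "\<dots> = form.dim ?W" by (rule form.basis_card_eq_dim[OF A'(2,4,3)])
    finally show "n * (n - 1) \<le> affine_dimension form_scale ?X"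
      using A(3) by (simp add: affine_dimension_translate[OF W_space_subspace])
  qed (rule dim_le[OF symp])

  have s0X: "s0 \<in> ?X"
    using form.subspace_0[OF W_space_subspace, of L] by (intro image_eqI[of _ _ 0]) auto
  \<comment> \<open>The contradiction comes from a \<open>y\<close> orthogonal to \<open>W\<close>
    under \<open>s0\<close> and outside \<open>span {x, a x}\<close>: some \<open>w\<close> in
    \<open>?W\<close> has \<open>w x y \<noteq> 0\<close>, so \<open>y\<close> is not orthogonal to
    \<open>W\<close> under \<open>s0 + w\<close>.\<close>
  have no_common_orthogonal: False if W: "subspace W" "W \<noteq> {0}" and iso: "\<And>s. s \<in> ?X \<Longrightarrow> W \<subseteq> orthogonal_of s W"
    and const: "\<And>s t. s \<in> ?X \<Longrightarrow> t \<in> ?X \<Longrightarrow> orthogonal_of s W = orthogonal_of t W" for W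
  proof -
    obtain x where x: "x \<in> W" "x \<noteq> 0" using W subspace_0 by blast
    obtain y where y: "y \<in> orthogonal_of s0 W" "y \<notin> span {x, a x}"
    proof (cases "W \<subseteq> span {x}")
      case True
      \<comment> \<open>The orthogonal of the line has dimension \<open>2 * n - 1\<close>, at least
        3 as \<open>n \<ge> 2\<close>, and cannot fit into a plane.\<close>
      have "dim UNIV = Suc (dim {q\<in>UNIV. s0 x q = 0})"
        using dim_kernel[OF subspace_UNIV s0.linear_right, of "a x" x] noniso[OF x(2)] by simp
      moreover have "dim (span {x, a x}) \<le> card {x, a x}"
        by (rule dim_le_card) auto
      moreover have "card {x, a x} \<le> 2" by (simp add: card_insert_if)
      ultimately have "\<not> {q\<in>UNIV. s0 x q = 0} \<subseteq> span {x, a x}"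
        using dim_subset[of "{q\<in>UNIV. s0 x q = 0}" "span {x, a x}"] assms(2,3) by linarith
      then obtain y where y: "s0 x y = 0" "y \<notin> span {x, a x}" by blast
      have "y \<in> orthogonal_of s0 W"
        using True y(1) by (auto simp: orthogonal_of_def span_singleton s0.scale_left)
      with y that show thesis by blast
    next
      case False
      then obtain y where y: "y \<in> W" "y \<notin> span {x}" by blast
      have orth: "y \<in> orthogonal_of s0 W" using iso[OF s0X] y(1) by blast
      \<comment> \<open>Isotropy of \<open>W\<close> gives \<open>s0 x y = 0\<close>, while
        \<open>s0 x (a x) \<noteq> 0\<close>, so \<open>y\<close> would have no component along
        \<open>a x\<close>.\<close>
      have "y \<notin> span {x, a x}"
      proof
        assume "y \<in> span {x, a x}"
        then obtain d where "y - sc d (a x) \<in> span {x}"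
          using span_breakdown_eq[of y "a x" "{x}"] by (auto simp: insert_commute)
        then obtain c where "y - sc d (a x) = sc c x" by (auto simp: span_singleton)
        then have c: "y = sc c x + sc d (a x)" by (simp add: diff_eq_eq)
        have "s0 x y = 0" using orth x(1) by (auto simp: orthogonal_of_def)
        then have "d = 0" using noniso[OF x(2)] by (simp add: c s0.simps)
        then show False using y(2) c by (simp add: span_base span_scale)
      qed
      with orth that show thesis by blast
    qed
    obtain w where w: "w \<in> ?W" "w x y \<noteq> 0"
      using W_space_separates[OF L_eq x(2) y(2)] by blast
    then have "y \<in> orthogonal_of (s0 + w) W" using const[OF s0X, of "s0 + w"] y(1) by blast
    then have "s0 x y + w x y = 0" using x(1) by (auto simp: orthogonal_of_def)
    moreover have "s0 x y = 0" using y(1) x(1) by (auto simp: orthogonal_of_def)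
    ultimately show False using w(2) by simp
  qed
  have "irreducible_symplectic_set sc ?X"
    unfolding irreducible_symplectic_set_def symplectic_forms_def
  proof (intro conjI notI)
    assume "\<exists>W. subspace W \<and> W \<noteq> {0} \<and> (\<forall>s\<in>?X. W \<subseteq> orthogonal_of s W) \<and>
      (\<forall>s\<in>?X. \<forall>t\<in>?X. orthogonal_of s W = orthogonal_of t W)"
    then show False by (elim exE conjE) (rule no_common_orthogonal, assumption+, blast+)
  qed (use s0X alt nondeg in auto)
  moreover have "optimal_symplectic_affine_subspace sc ?X"
    unfolding optimal_symplectic_affine_subspace_def using symp dim_le dim_X by simp
  ultimately show ?thesis using dim_X by blast
qed

end
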